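(* Over $\mathsf{RCA_0}$, for every (external) natural number $k$, the following are equivalent: (1) the union of any $k$ inductively $H$-well-founded binary relations is inductively $H$-well-founded; (2) the union of any $k$ $H$-well-founded binary relations is $H$-well-founded; (3) $\mathsf{RT}^2_k$.
   Context: For a binary relation $R$ on $S\subseteq\mathbb{N}$, $H(R)$ is the set of finite sequences $\langle x_0,\dots,x_{n-1}\rangle$ with $x_j\,R\,x_i$ for all $i<j<n$. On finite sequences, $\langle y_0,\dots,y_k\rangle\succ\langle x_0,\dots,x_h\rangle$ iff $k=h+1$ and $y_i=x_i$ for $i\le h$. $R$ is $H$-well-founded if there is no infinite $\succ$-increasing chain $s_0\prec s_1\prec\cdots$ in $H(R)$ (equivalently, no infinite sequence $(a_n)$ with $a_m\,R\,a_n$ for all $n<m$). $R$ is inductively $H$-well-founded if $\succ$ on $H(R)$ is inductively well-founded: every $X\subseteq H(R)$ with $\forall y\in H(R)\,(\forall z\in H(R)\,(z\succ y\to z\in X)\to y\in X)$ equals $H(R)$. $\mathsf{RT}^2_k$: for every $P:[\mathbb{N}]^2\to k$ there is an infinite $H\subseteq\mathbb{N}$ with $P$ constant on $[H]^2$. *)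

theory Defs
  imports Main
begin

section \<open>The language of second-order arithmetic and its structures\<close>

text \<open>
  "Over \<open>RCA\<^sub>0\<close>, A and B are equivalent" is rendered as: A and B have the same truth value in
  every structure \<open>(M, S)\<close> for the language of second-order arithmetic that satisfies the axioms
  of \<open>RCA\<^sub>0\<close>.  \<open>M\<close> need not be the standard model, and set variables range over an arbitrary
  family \<open>S\<close> of subsets of \<open>M\<close>.  The number domain is an arbitrary type; everything that is said
  inside such a structure quantifies only over numbers (the type) and over \<open>set_domain\<close>.
\<close>

record 'a l2_structure =
  n_zero :: 'a ("\<zero>\<index>")
  n_one :: 'a ("\<one>\<index>")
  n_plus :: "'a \<Rightarrow> 'a \<Rightarrow> 'a" (infixl "\<oplus>\<index>" 65)
  n_times :: "'a \<Rightarrow> 'a \<Rightarrow> 'a" (infixl "\<otimes>\<index>" 70)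
  n_less :: "'a \<Rightarrow> 'a \<Rightarrow> bool" (infix "\<sqsubset>\<index>" 50)
  set_domain :: "'a set set"

datatype tm = Var nat | Zero | One | Plus tm tm | Times tm tm

text \<open>Number variables and set variables are two separate copies of \<^typ>\<open>nat\<close>.\<close>

datatype fm =
    Eq tm tm | Less tm tm | Mem tm nat
  | Neg fm | Conj fm fm | Disj fm fm | Imp fm fm
  | AllN nat fm | ExN nat fm | AllS nat fm | ExS nat fm

primrec tm_vars :: "tm \<Rightarrow> nat set" where
  "tm_vars (Var x) = {x}"
| "tm_vars Zero = {}"
| "tm_vars One = {}"
| "tm_vars (Plus t u) = tm_vars t \<union> tm_vars u"
| "tm_vars (Times t u) = tm_vars t \<union> tm_vars u"

inductive bounded_fm :: "fm \<Rightarrow> bool" where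
  "bounded_fm (Eq t u)"
| "bounded_fm (Less t u)"
| "bounded_fm (Mem t X)"
| "bounded_fm p \<Longrightarrow> bounded_fm (Neg p)"
| "bounded_fm p \<Longrightarrow> bounded_fm q \<Longrightarrow> bounded_fm (Conj p q)"
| "bounded_fm p \<Longrightarrow> bounded_fm q \<Longrightarrow> bounded_fm (Disj p q)"
| "bounded_fm p \<Longrightarrow> bounded_fm q \<Longrightarrow> bounded_fm (Imp p q)"
| "bounded_fm p \<Longrightarrow> x \<notin> tm_vars t \<Longrightarrow> bounded_fm (AllN x (Imp (Less (Var x) t) p))"
| "bounded_fm p \<Longrightarrow> x \<notin> tm_vars t \<Longrightarrow> bounded_fm (ExN x (Conj (Less (Var x) t) p))"

definition Sigma01 :: "fm \<Rightarrow> bool" where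
  "Sigma01 p \<longleftrightarrow> (\<exists>x q. p = ExN x q \<and> bounded_fm q)"

definition Pi01 :: "fm \<Rightarrow> bool" where
  "Pi01 p \<longleftrightarrow> (\<exists>x q. p = AllN x q \<and> bounded_fm q)"

context
  fixes M :: "'a l2_structure" (structure)
begin

primrec val :: "(nat \<Rightarrow> 'a) \<Rightarrow> tm \<Rightarrow> 'a" where
  "val e (Var x) = e x"
| "val e Zero = \<zero>"
| "val e One = \<one>"
| "val e (Plus t u) = val e t \<oplus> val e u"
| "val e (Times t u) = val e t \<otimes> val e u"

primrec sat :: "(nat \<Rightarrow> 'a) \<Rightarrow> (nat \<Rightarrow> 'a set) \<Rightarrow> fm \<Rightarrow> bool" where
  "sat e E (Eq t u) \<longleftrightarrow> val e t = val e u"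
| "sat e E (Less t u) \<longleftrightarrow> val e t \<sqsubset> val e u"
| "sat e E (Mem t X) \<longleftrightarrow> val e t \<in> E X"
| "sat e E (Neg p) \<longleftrightarrow> \<not> sat e E p"
| "sat e E (Conj p q) \<longleftrightarrow> sat e E p \<and> sat e E q"
| "sat e E (Disj p q) \<longleftrightarrow> sat e E p \<or> sat e E q"
| "sat e E (Imp p q) \<longleftrightarrow> (sat e E p \<longrightarrow> sat e E q)"
| "sat e E (AllN x p) \<longleftrightarrow> (\<forall>a. sat (e(x := a)) E p)"
| "sat e E (ExN x p) \<longleftrightarrow> (\<exists>a. sat (e(x := a)) E p)"
| "sat e E (AllS X p) \<longleftrightarrow> (\<forall>A \<in> set_domain M. sat e (E(X := A)) p)"
| "sat e E (ExS X p) \<longleftrightarrow> (\<exists>A \<in> set_domain M. sat e (E(X := A)) p)"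


section \<open>The axioms of \<open>RCA\<^sub>0\<close>\<close>

definition basic_axioms :: bool where
  "basic_axioms \<longleftrightarrow>
     (\<forall>n. n \<oplus> \<one> \<noteq> \<zero>) \<and>
     (\<forall>m n. m \<oplus> \<one> = n \<oplus> \<one> \<longrightarrow> m = n) \<and>
     (\<forall>m. m \<oplus> \<zero> = m) \<and>
     (\<forall>m n. m \<oplus> (n \<oplus> \<one>) = (m \<oplus> n) \<oplus> \<one>) \<and>
     (\<forall>m. m \<otimes> \<zero> = \<zero>) \<and>
     (\<forall>m n. m \<otimes> (n \<oplus> \<one>) = (m \<otimes> n) \<oplus> m) \<and>
     (\<forall>m. \<not> m \<sqsubset> \<zero>) \<and>
     (\<forall>m n. m \<sqsubset> n \<oplus> \<one> \<longleftrightarrow> m \<sqsubset> n \<or> m = n)"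

text \<open>
  In both schemes the assignments \<open>e\<close> and \<open>E\<close> supply the number and set parameters, and \<open>x\<close> is
  the variable on which one does induction or comprehension.
\<close>

definition Sigma01_induction :: bool where
  "Sigma01_induction \<longleftrightarrow>
     (\<forall>p x e E. Sigma01 p \<longrightarrow> range E \<subseteq> set_domain M \<longrightarrow>
        sat (e(x := \<zero>)) E p \<longrightarrow>
        (\<forall>n. sat (e(x := n)) E p \<longrightarrow> sat (e(x := n \<oplus> \<one>)) E p) \<longrightarrow>
        (\<forall>n. sat (e(x := n)) E p))"

definition Delta01_comprehension :: bool where
  "Delta01_comprehension \<longleftrightarrow>
     (\<forall>p q x e E. Sigma01 p \<longrightarrow> Pi01 q \<longrightarrow> range E \<subseteq> set_domain M \<longrightarrow>
        (\<forall>n. sat (e(x := n)) E p \<longleftrightarrow> sat (e(x := n)) E q) \<longrightarrow>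
        (\<exists>X \<in> set_domain M. \<forall>n. n \<in> X \<longleftrightarrow> sat (e(x := n)) E p))"

text \<open>
  Like the number domain, the domain of the set variables of a structure is nonempty.  This has
  to be said: without it, the two schemes would be vacuous when \<open>set_domain\<close> is empty.
\<close>

definition RCA0_model :: bool where
  "RCA0_model \<longleftrightarrow>
     set_domain M \<noteq> {} \<and> basic_axioms \<and> Sigma01_induction \<and> Delta01_comprehension"


section \<open>Coding pairs, functions and finite sequences inside a structure\<close>

text \<open>The pairing function \<open>(m, n) = (m + n)\<^sup>2 + m\<close> usual in \<open>RCA\<^sub>0\<close>; it is injective, not onto.\<close>

definition pair :: "'a \<Rightarrow> 'a \<Rightarrow> 'a" where
  "pair m n = (m \<oplus> n) \<otimes> (m \<oplus> n) \<oplus> m"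

definition divides :: "'a \<Rightarrow> 'a \<Rightarrow> bool" where
  "divides d n \<longleftrightarrow> (\<exists>q. n = q \<otimes> d)"

text \<open>
  Following Simpson, a number \<open>(k, (m, n))\<close> represents the finite set of all \<open>i < k\<close> such that
  \<open>m(i + 1) + 1\<close> divides \<open>n\<close>; the code of a finite set is its least representative, so that each
  finite set has exactly one code.  Finite means finite in the sense of the structure.
\<close>

definition set_rep :: "'a \<Rightarrow> bool" where
  "set_rep c \<longleftrightarrow> (\<exists>k m n. c = pair k (pair m n))"

definition elems :: "'a \<Rightarrow> 'a set" where
  "elems c = {i. \<exists>k m n. c = pair k (pair m n) \<and> i \<sqsubset> k \<and>
                         divides (m \<otimes> (i \<oplus> \<one>) \<oplus> \<one>) n}"

definition set_code :: "'a \<Rightarrow> bool" where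
  "set_code c \<longleftrightarrow> set_rep c \<and> (\<forall>d. d \<sqsubset> c \<longrightarrow> set_rep d \<longrightarrow> elems d \<noteq> elems c)"

text \<open>A finite sequence of length \<open>l\<close> is a finite set of pairs that is a function on \<open>{i. i < l}\<close>.\<close>

definition seq_of_length :: "'a \<Rightarrow> 'a \<Rightarrow> bool" where
  "seq_of_length s l \<longleftrightarrow>
     set_code s \<and>
     (\<forall>p \<in> elems s. \<exists>i x. p = pair i x \<and> i \<sqsubset> l) \<and>
     (\<forall>i. i \<sqsubset> l \<longrightarrow> (\<exists>!x. pair i x \<in> elems s))"

abbreviation entry :: "'a \<Rightarrow> 'a \<Rightarrow> 'a \<Rightarrow> bool" where
  "entry s i x \<equiv> pair i x \<in> elems s"

definition total_function :: "'a set \<Rightarrow> bool" where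
  "total_function F \<longleftrightarrow>
     F \<in> set_domain M \<and> (\<forall>p \<in> F. \<exists>n x. p = pair n x) \<and> (\<forall>n. \<exists>!x. pair n x \<in> F)"


section \<open>\<open>H\<close>-well-foundedness\<close>

text \<open>A binary relation \<open>R\<close> is a set of pairs of the structure; \<open>x R y\<close> is \<open>pair x y \<in> R\<close>.\<close>

definition relation_on :: "'a set \<Rightarrow> 'a set \<Rightarrow> bool" where
  "relation_on S R \<longleftrightarrow> R \<in> set_domain M \<and> (\<forall>p \<in> R. \<exists>x \<in> S. \<exists>y \<in> S. p = pair x y)"

definition H_of :: "'a set \<Rightarrow> 'a set \<Rightarrow> 'a set" where
  "H_of S R = {s. \<exists>l. seq_of_length s l \<and>
                   (\<forall>i x. entry s i x \<longrightarrow> x \<in> S) \<and>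
                   (\<forall>i j x y. i \<sqsubset> j \<longrightarrow> j \<sqsubset> l \<longrightarrow> entry s i x \<longrightarrow> entry s j y \<longrightarrow> pair y x \<in> R)}"

text \<open>
  \<open>extends t s\<close> is \<open>t \<succ> s\<close>: \<open>t\<close> is \<open>s\<close> with one entry appended.  In particular the
  sequences of length one are exactly the extensions of the empty sequence.
\<close>

definition extends :: "'a \<Rightarrow> 'a \<Rightarrow> bool" where
  "extends t s \<longleftrightarrow>
     (\<exists>l. seq_of_length s l \<and> seq_of_length t (l \<oplus> \<one>) \<and>
          (\<forall>i x. i \<sqsubset> l \<longrightarrow> (entry t i x \<longleftrightarrow> entry s i x)))"

definition H_wf :: "'a set \<Rightarrow> 'a set \<Rightarrow> bool" where
  "H_wf S R \<longleftrightarrow>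
     \<not> (\<exists>F. total_function F \<and>
            (\<forall>n s. pair n s \<in> F \<longrightarrow> s \<in> H_of S R) \<and>
            (\<forall>n s t. pair n s \<in> F \<longrightarrow> pair (n \<oplus> \<one>) t \<in> F \<longrightarrow> extends t s))"

definition ind_H_wf :: "'a set \<Rightarrow> 'a set \<Rightarrow> bool" where
  "ind_H_wf S R \<longleftrightarrow>
     (\<forall>X \<in> set_domain M. X \<subseteq> H_of S R \<longrightarrow>
        (\<forall>y \<in> H_of S R. (\<forall>z \<in> H_of S R. extends z y \<longrightarrow> z \<in> X) \<longrightarrow> y \<in> X) \<longrightarrow>
        X = H_of S R)"

text \<open>
  The number \<open>k\<close> is an external (standard) natural number, so that the \<open>k\<close> relations are given
  one by one and need not form a sequence in the sense of the structure.
\<close>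

definition union_ind_H_wf :: "nat \<Rightarrow> bool" where
  "union_ind_H_wf k \<longleftrightarrow>
     (\<forall>S \<in> set_domain M. \<forall>R :: nat \<Rightarrow> 'a set.
        (\<forall>i<k. relation_on S (R i) \<and> ind_H_wf S (R i)) \<longrightarrow> ind_H_wf S (\<Union>i<k. R i))"

definition union_H_wf :: "nat \<Rightarrow> bool" where
  "union_H_wf k \<longleftrightarrow>
     (\<forall>S \<in> set_domain M. \<forall>R :: nat \<Rightarrow> 'a set.
        (\<forall>i<k. relation_on S (R i) \<and> H_wf S (R i)) \<longrightarrow> H_wf S (\<Union>i<k. R i))"


section \<open>Ramsey's theorem for pairs\<close>

primrec numeral_of :: "nat \<Rightarrow> 'a" where
  "numeral_of 0 = \<zero>"
| "numeral_of (Suc n) = numeral_of n \<oplus> \<one>"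

text \<open>An unordered pair \<open>{x, y}\<close> with \<open>x < y\<close> is represented by \<open>pair x y\<close>.\<close>

definition colouring :: "nat \<Rightarrow> 'a set \<Rightarrow> bool" where
  "colouring k P \<longleftrightarrow>
     P \<in> set_domain M \<and>
     (\<forall>p \<in> P. \<exists>x y c. p = pair (pair x y) c \<and> x \<sqsubset> y \<and> c \<sqsubset> numeral_of k) \<and>
     (\<forall>x y. x \<sqsubset> y \<longrightarrow> (\<exists>!c. pair (pair x y) c \<in> P))"

definition infinite_set :: "'a set \<Rightarrow> bool" where
  "infinite_set A \<longleftrightarrow> A \<in> set_domain M \<and> (\<forall>n. \<exists>m \<in> A. n \<sqsubset> m)"

definition RT2 :: "nat \<Rightarrow> bool" where
  "RT2 k \<longleftrightarrow>
     (\<forall>P. colouring k P \<longrightarrow>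
        (\<exists>A. infinite_set A \<and>
             (\<exists>c. \<forall>x \<in> A. \<forall>y \<in> A. x \<sqsubset> y \<longrightarrow> pair (pair x y) c \<in> P)))"

end

end

theory Submission imports Defs begin

text \<open>
  \<open>H\<close>-well-foundedness of \<open>R\<close> says that there is no sequence \<open>(a\<^sub>n)\<close> of the structure with
  \<open>a\<^sub>n R a\<^sub>m\<close> for all \<open>m < n\<close>.  Given such a sequence for a union of \<open>k\<close> relations, colour
  \<open>{m, n}\<close> by an index \<open>i\<close> with \<open>a\<^sub>n R\<^sub>i a\<^sub>m\<close>; a homogeneous set yields a subsequence for a single
  \<open>R\<^sub>i\<close>.  Conversely a colouring \<open>P\<close> splits the relation \<open>y > x\<close>, which is not \<open>H\<close>-well-founded, into
  the relations \<open>P(x, y) = i\<close>, and a sequence for one of these has a homogeneous range.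
  The inductive notion agrees with the other one relation by relation: the complement of an infinite
  chain is progressive, and a failure of induction produces a chain by dependent choice
  for bounded formulas, taking least witnesses.

  All of this happens inside an arbitrary model, so definability has to be tracked.  Predicates of
  an environment \<open>e :: nat \<Rightarrow> 'a\<close> are called \<open>delta0\<close> or \<open>sigma1\<close> if a formula with parameters from
  the model defines them; bound variables are handled in de Bruijn style, so that the closure rules
  can be applied to ordinary HOL terms by backward chaining.
\<close>

section \<open>Definability with parameters\<close>

primrec ren_tm :: "(nat \<Rightarrow> nat) \<Rightarrow> tm \<Rightarrow> tm" where
  "ren_tm f (Var x) = Var (f x)"
| "ren_tm f Zero = Zero"
| "ren_tm f One = One"
| "ren_tm f (Plus t u) = Plus (ren_tm f t) (ren_tm f u)"
| "ren_tm f (Times t u) = Times (ren_tm f t) (ren_tm f u)"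

primrec ren_fm :: "(nat \<Rightarrow> nat) \<Rightarrow> (nat \<Rightarrow> nat) \<Rightarrow> fm \<Rightarrow> fm" where
  "ren_fm f g (Eq t u) = Eq (ren_tm f t) (ren_tm f u)"
| "ren_fm f g (Less t u) = Less (ren_tm f t) (ren_tm f u)"
| "ren_fm f g (Mem t X) = Mem (ren_tm f t) (g X)"
| "ren_fm f g (Neg p) = Neg (ren_fm f g p)"
| "ren_fm f g (Conj p q) = Conj (ren_fm f g p) (ren_fm f g q)"
| "ren_fm f g (Disj p q) = Disj (ren_fm f g p) (ren_fm f g q)"
| "ren_fm f g (Imp p q) = Imp (ren_fm f g p) (ren_fm f g q)"
| "ren_fm f g (AllN x p) = AllN (f x) (ren_fm f g p)"
| "ren_fm f g (ExN x p) = ExN (f x) (ren_fm f g p)"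
| "ren_fm f g (AllS X p) = AllS (g X) (ren_fm f g p)"
| "ren_fm f g (ExS X p) = ExS (g X) (ren_fm f g p)"

lemma val_ren_tm: "val M e (ren_tm f t) = val M (\<lambda>n. e (f n)) t"
  by (induction t) auto

lemma tm_vars_ren_tm: "tm_vars (ren_tm f t) = f ` tm_vars t"
  by (induction t) auto

text \<open>Injectivity of \<open>f\<close> preserves the side condition that a bounded variable
  does not occur in its bounding term.\<close>

lemma bounded_ren_fm:
  assumes "bounded_fm p" "inj f"
  shows "bounded_fm (ren_fm f g p)"
  using assms by (induction p) (auto intro!: bounded_fm.intros simp: tm_vars_ren_tm inj_image_mem_iff)

lemma upd_comp_inj: "inj f \<Longrightarrow> (\<lambda>n. (e(f x := a)) (f n)) = (\<lambda>n. e (f n))(x := a)"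
  by (auto simp: inj_def)

text \<open>Bounded formulas bind no set variables, so only the renaming \<open>f\<close> of number
  variables has to be injective to avoid capture; \<open>g\<close> may identify set
  variables.\<close>

lemma sat_ren_fm:
  assumes "bounded_fm p" "inj f"
  shows "sat M e E (ren_fm f g p) \<longleftrightarrow> sat M (\<lambda>n. e (f n)) (\<lambda>n. E (g n)) p"
  using assms
  by (induction arbitrary: e)
     (simp_all add: val_ren_tm upd_comp_inj fun_upd_same del: fun_upd_apply)

text \<open>
  Even variables carry the arguments of a definable predicate, odd ones its number parameters.
\<close>

definition mix :: "(nat \<Rightarrow> 'b) \<Rightarrow> (nat \<Rightarrow> 'b) \<Rightarrow> nat \<Rightarrow> 'b" where
  "mix e c n = (if even n then e (n div 2) else c (n div 2))"

lemma mix_simps [simp]: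
  "mix e c (2 * n) = e n" "mix e c (Suc (2 * n)) = c n" "mix e c 0 = e 0" "mix e c (Suc 0) = c 0"
  by (simp_all add: mix_def)

lemma range_mix: "range (mix E F) = range E \<union> range F"
proof -
  have "E n \<in> range (mix E F)" "F n \<in> range (mix E F)" for n
    by (metis mix_simps(1) rangeI, metis mix_simps(2) rangeI)
  moreover have "mix E F n \<in> range E \<union> range F" for n
    by (simp add: mix_def)
  ultimately show ?thesis by blast
qed

text \<open>Two parameter lists are pooled as \<open>mix c d\<close>, which puts \<open>c\<close> on
  the variables 4j + 1 and \<open>d\<close> on 4j + 3. The renamings \<open>mixl\<close> and
  \<open>mixr\<close> send 2j + 1 to these places and fix the even variables, that is, the
  arguments.\<close>

abbreviation mixl :: "nat \<Rightarrow> nat" where "mixl n \<equiv> if even n then n else 2 * n - 1"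
abbreviation mixr :: "nat \<Rightarrow> nat" where "mixr n \<equiv> if even n then n else 2 * n + 1"

lemma mix_mixl: "(\<lambda>n. mix e (mix c d) (mixl n)) = mix e c"
proof
  fix n show "mix e (mix c d) (mixl n) = mix e c n"
  proof (cases "even n")
    case False
    then obtain j where "n = 2 * j + 1" by (elim oddE)
    then have "mixl n = Suc (2 * (2 * j))" "n = Suc (2 * j)" by auto
    then show ?thesis by (simp only: mix_simps)
  qed (simp add: mix_def)
qed

lemma mix_mixr: "(\<lambda>n. mix e (mix c d) (mixr n)) = mix e d"
proof
  fix n show "mix e (mix c d) (mixr n) = mix e d n"
  proof (cases "even n")
    case False
    then obtain j where "n = 2 * j + 1" by (elim oddE)
    then have "mixr n = Suc (2 * (Suc (2 * j)))" "n = Suc (2 * j)" by auto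
    then show ?thesis by (simp only: mix_simps)
  qed (simp add: mix_def)
qed

lemma inj_mixl: "inj mixl"
  by (rule injI) (auto split: if_splits elim!: oddE)

lemma inj_mixr: "inj mixr"
  by (rule injI) (auto split: if_splits elim!: oddE)

text \<open>
  Moves argument 0 to the odd variable 1, where it can be bound without disturbing the others.
\<close>

abbreviation unshift :: "nat \<Rightarrow> nat" where
  "unshift n \<equiv> if n = 0 then 1 else if even n then n - 2 else n + 2"

lemma inj_unshift: "inj unshift"
  by (rule injI) (simp split: if_splits, presburger+)

text \<open>The dummy parameter \<open>b\<close> reserves variable 1 for a quantifier. After
  \<open>unshift\<close>, a formula reads the value assigned there as argument 0 and the former
  arguments one place later.\<close>

lemma mix_unshift:
  "(\<lambda>n. ((mix e (case_nat b d))(1 := a)) (unshift n)) = mix (case_nat a e) d"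
proof
  fix n
  consider "n = 0" | j where "n = 2 * Suc j" | j where "n = Suc (2 * j)"
    by (metis Suc_eq_plus1 evenE mult_0_right not0_implies_Suc oddE)
  then show "((mix e (case_nat b d))(1 := a)) (unshift n) = mix (case_nat a e) d n"
  proof cases
    case 1 then show ?thesis by simp
  next
    case 2
    then have "unshift n = 2 * j" by simp
    then show ?thesis using 2 by (simp only: mix_simps fun_upd_apply) simp
  next
    case 3
    then have "unshift n = Suc (2 * Suc j)" by simp
    then show ?thesis using 3 by (simp only: mix_simps fun_upd_apply nat.case) simp
  qed
qed

text \<open>Here \<open>mixr\<close> sends odd variables to numbers from 3 on, so a term renamed by
  it does not see the value assigned to variable 1. This is what the bounding term of a quantifier
  needs.\<close>

lemma mix_case_mixr: "(\<lambda>n. ((mix e (case_nat b (mix c d)))(1 := a)) (mixr n)) = mix e c"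
proof
  fix n show "((mix e (case_nat b (mix c d)))(1 := a)) (mixr n) = mix e c n"
  proof (cases "even n")
    case False
    then obtain j where "n = 2 * j + 1" by (elim oddE)
    then have "mixr n = Suc (2 * Suc (2 * j))" "n = Suc (2 * j)" by auto
    then show ?thesis by (simp only: mix_simps fun_upd_apply nat.case) simp
  qed (auto simp: mix_def)
qed

locale rca0 =
  fixes M :: "'a l2_structure" (structure)
  assumes model: "RCA0_model M"
begin

section \<open>Definable functions and predicates of an environment, and their closure rules\<close>

definition term_fn :: "((nat \<Rightarrow> 'a) \<Rightarrow> 'a) \<Rightarrow> bool" where
  "term_fn t \<longleftrightarrow> (\<exists>u c. \<forall>e. t e = val M (mix e c) u)"

definition delta0 :: "((nat \<Rightarrow> 'a) \<Rightarrow> bool) \<Rightarrow> bool" where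
  "delta0 P \<longleftrightarrow> (\<exists>p c E. bounded_fm p \<and> range E \<subseteq> set_domain M \<and>
                        (\<forall>e. P e \<longleftrightarrow> sat M (mix e c) E p))"

text \<open>The matrix is applied to \<open>\<lambda>n. e (Suc n)\<close> and \<open>e 0\<close> so
  that a HOL quantifier \<open>\<exists>x. Q e x\<close> matches it by higher-order unification,
  with the witness as the new argument 0.\<close>

definition sigma1 :: "((nat \<Rightarrow> 'a) \<Rightarrow> bool) \<Rightarrow> bool" where
  "sigma1 P \<longleftrightarrow> (\<exists>Q. delta0 (\<lambda>e. Q (\<lambda>n. e (Suc n)) (e 0)) \<and> P = (\<lambda>e. \<exists>x. Q e x))"

lemma term_fn_var: "term_fn (\<lambda>e. e n)"
  unfolding term_fn_def by (rule exI[of _ "Var (2 * n)"]) simp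

lemma term_fn_const: "term_fn (\<lambda>e. a)"
  unfolding term_fn_def by (rule exI[of _ "Var 1"], rule exI[of _ "\<lambda>_. a"]) simp

lemma term_fn_merge:
  assumes "term_fn t" "term_fn u"
  obtains v w c where "\<And>e. t e = val M (mix e c) v" "\<And>e. u e = val M (mix e c) w"
proof -
  from assms obtain v c w d where "\<And>e. t e = val M (mix e c) v" "\<And>e. u e = val M (mix e d) w"
    unfolding term_fn_def by metis
  then have "t e = val M (mix e (mix c d)) (ren_tm mixl v)" "u e = val M (mix e (mix c d)) (ren_tm mixr w)" for e
    unfolding val_ren_tm mix_mixl mix_mixr by auto
  then show ?thesis by (rule that)
qed

lemma term_fn_plus:
  assumes "term_fn t" "term_fn u"
  shows "term_fn (\<lambda>e. t e \<oplus> u e)"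
proof -
  from assms obtain v w c where "\<And>e. t e = val M (mix e c) v" "\<And>e. u e = val M (mix e c) w"
    by (rule term_fn_merge) blast
  then show ?thesis unfolding term_fn_def by (intro exI[of _ "Plus v w"] exI[of _ c]) simp
qed

lemma term_fn_times:
  assumes "term_fn t" "term_fn u"
  shows "term_fn (\<lambda>e. t e \<otimes> u e)"
proof -
  from assms obtain v w c where "\<And>e. t e = val M (mix e c) v" "\<And>e. u e = val M (mix e c) w"
    by (rule term_fn_merge) blast
  then show ?thesis unfolding term_fn_def by (intro exI[of _ "Times v w"] exI[of _ c]) simp
qed

lemma term_fn_pair: "term_fn t \<Longrightarrow> term_fn u \<Longrightarrow> term_fn (\<lambda>e. pair M (t e) (u e))"
  unfolding pair_def by (intro term_fn_plus term_fn_times)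

text \<open>Terms bind nothing, so \<open>f\<close> is arbitrary. The rule lifts a term below the
  quantifiers under which it is used.\<close>

lemma term_fn_ren:
  assumes "term_fn t"
  shows "term_fn (\<lambda>e. t (\<lambda>n. e (f n)))"
proof -
  from assms obtain u c where u: "\<And>e. t e = val M (mix e c) u" unfolding term_fn_def by metis
  define g where "g n = (if even n then 2 * f (n div 2) else n)" for n
  have "mix e c (g n) = mix (\<lambda>n. e (f n)) c n" for e n
    by (auto simp: g_def mix_def)
  then show ?thesis unfolding term_fn_def
    by (intro exI[of _ "ren_tm g u"] exI[of _ c]) (simp add: val_ren_tm u)
qed

text \<open>Supplies a set assignment for formulas without set variables; it exists because the set
  domain of a model is nonempty.\<close>

lemma obtain_set: obtains E :: "nat \<Rightarrow> 'a set" where "range E \<subseteq> set_domain M"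
proof -
  obtain A where "A \<in> set_domain M" using model by (auto simp: RCA0_model_def)
  then show ?thesis by (intro that[of "\<lambda>_. A"]) auto
qed

lemma delta0_eq:
  assumes "term_fn t" "term_fn u"
  shows "delta0 (\<lambda>e. t e = u e)"
proof -
  from assms obtain v w c where "\<And>e. t e = val M (mix e c) v" "\<And>e. u e = val M (mix e c) w"
    by (rule term_fn_merge) blast
  moreover obtain E :: "nat \<Rightarrow> 'a set" where "range E \<subseteq> set_domain M" by (rule obtain_set)
  ultimately show ?thesis unfolding delta0_def
    by (intro exI[of _ "Eq v w"] exI[of _ c] exI[of _ E]) (simp add: bounded_fm.intros)
qed

lemma delta0_less:
  assumes "term_fn t" "term_fn u"
  shows "delta0 (\<lambda>e. t e \<sqsubset> u e)"
proof -
  from assms obtain v w c where "\<And>e. t e = val M (mix e c) v" "\<And>e. u e = val M (mix e c) w"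
    by (rule term_fn_merge) blast
  moreover obtain E :: "nat \<Rightarrow> 'a set" where "range E \<subseteq> set_domain M" by (rule obtain_set)
  ultimately show ?thesis unfolding delta0_def
    by (intro exI[of _ "Less v w"] exI[of _ c] exI[of _ E]) (simp add: bounded_fm.intros)
qed

lemma delta0_mem:
  assumes "term_fn t" "A \<in> set_domain M"
  shows "delta0 (\<lambda>e. t e \<in> A)"
proof -
  from assms obtain v c where "\<And>e. t e = val M (mix e c) v" unfolding term_fn_def by metis
  then show ?thesis using assms unfolding delta0_def
    by (intro exI[of _ "Mem v 0"] exI[of _ c] exI[of _ "\<lambda>_. A"]) (auto simp: bounded_fm.intros)
qed

lemma delta0_neg: "delta0 P \<Longrightarrow> delta0 (\<lambda>e. \<not> P e)"
  unfolding delta0_def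
proof (elim exE conjE)
  fix p c E
  assume "bounded_fm p" "range E \<subseteq> set_domain M" "\<forall>e. P e = sat M (mix e c) E p"
  then show "\<exists>p c E. bounded_fm p \<and> range E \<subseteq> set_domain M \<and> (\<forall>e. (\<not> P e) = sat M (mix e c) E p)"
    by (intro exI[of _ "Neg p"] exI[of _ c] exI[of _ E]) (simp add: bounded_fm.intros)
qed

text \<open>Number parameters are pooled by \<open>mixl\<close> and \<open>mixr\<close>, set
  parameters by sending the set variables of \<open>p\<close> to even and those of \<open>q\<close>
  to odd ones.\<close>

lemma delta0_merge:
  assumes "delta0 P" "delta0 Q"
  obtains p q c E where "bounded_fm p" "bounded_fm q" "range E \<subseteq> set_domain M"
    "\<And>e. P e \<longleftrightarrow> sat M (mix e c) E p" "\<And>e. Q e \<longleftrightarrow> sat M (mix e c) E q"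
proof -
  from assms(1) obtain p c E where p: "bounded_fm p" "range E \<subseteq> set_domain M" "\<And>e. P e \<longleftrightarrow> sat M (mix e c) E p"
    unfolding delta0_def by metis
  from assms(2) obtain q d F where q: "bounded_fm q" "range F \<subseteq> set_domain M" "\<And>e. Q e \<longleftrightarrow> sat M (mix e d) F q"
    unfolding delta0_def by metis
  let ?p = "ren_fm mixl (\<lambda>n. 2 * n) p" and ?q = "ren_fm mixr (\<lambda>n. Suc (2 * n)) q"
  have "sat M (mix e (mix c d)) (mix E F) ?p \<longleftrightarrow> P e" for e
    unfolding p sat_ren_fm[OF p(1) inj_mixl] mix_mixl mix_simps ..
  moreover have "sat M (mix e (mix c d)) (mix E F) ?q \<longleftrightarrow> Q e" for e
    unfolding q sat_ren_fm[OF q(1) inj_mixr] mix_mixr mix_simps ..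
  moreover have "range (mix E F) \<subseteq> set_domain M" using p q by (simp add: range_mix)
  ultimately show ?thesis
    by (intro that[OF bounded_ren_fm[OF p(1) inj_mixl] bounded_ren_fm[OF q(1) inj_mixr]]) auto
qed

lemma delta0_conj:
  assumes "delta0 P" "delta0 Q"
  shows "delta0 (\<lambda>e. P e \<and> Q e)"
  using assms
proof (rule delta0_merge)
  fix p q c E
  assume *: "bounded_fm p" "bounded_fm q" "range E \<subseteq> set_domain M"
    "\<And>e. P e \<longleftrightarrow> sat M (mix e c) E p" "\<And>e. Q e \<longleftrightarrow> sat M (mix e c) E q"
  then show ?thesis unfolding delta0_def
    by (intro exI[of _ "Conj p q"] exI[of _ c] exI[of _ E]) (simp add: bounded_fm.intros)
qed

lemma delta0_disj: "delta0 P \<Longrightarrow> delta0 Q \<Longrightarrow> delta0 (\<lambda>e. P e \<or> Q e)"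
  using delta0_neg[OF delta0_conj[OF delta0_neg delta0_neg]] by simp

lemma delta0_imp: "delta0 P \<Longrightarrow> delta0 Q \<Longrightarrow> delta0 (\<lambda>e. P e \<longrightarrow> Q e)"
  unfolding imp_conv_disj by (rule delta0_disj[OF delta0_neg])

lemma delta0_iff: "delta0 P \<Longrightarrow> delta0 Q \<Longrightarrow> delta0 (\<lambda>e. P e \<longleftrightarrow> Q e)"
  unfolding iff_conv_conj_imp by (rule delta0_conj[OF delta0_imp delta0_imp])

lemma delta0_ren:
  assumes "delta0 P" "inj f"
  shows "delta0 (\<lambda>e. P (\<lambda>n. e (f n)))"
proof -
  from assms(1) obtain p c E where p: "bounded_fm p" "range E \<subseteq> set_domain M" "\<And>e. P e \<longleftrightarrow> sat M (mix e c) E p"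
    unfolding delta0_def by metis
  define g where "g n = (if even n then 2 * f (n div 2) else n)" for n
  have "mix e c (g n) = mix (\<lambda>n. e (f n)) c n" for e n
    by (auto simp: g_def mix_def)
  moreover have g: "inj g"
    by (rule injI) (simp add: g_def inj_eq[OF assms(2)] split: if_splits, presburger+)
  ultimately show ?thesis using p bounded_ren_fm[OF p(1) g] unfolding delta0_def
    by (intro exI[of _ "ren_fm g id p"] exI[of _ c] exI[of _ E]) (simp add: sat_ren_fm)
qed

lemma delta0_bex:
  assumes "term_fn t" "delta0 (\<lambda>e. Q (\<lambda>n. e (Suc n)) (e 0))"
  shows "delta0 (\<lambda>e. \<exists>x. x \<sqsubset> t e \<and> Q e x)"
proof -
  from assms(1) obtain u c where u: "\<And>e. t e = val M (mix e c) u" unfolding term_fn_def by metis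
  from assms(2) obtain p d E where p: "bounded_fm p" "range E \<subseteq> set_domain M"
    "\<And>e. Q (\<lambda>n. e (Suc n)) (e 0) \<longleftrightarrow> sat M (mix e d) E p"
    unfolding delta0_def by metis
  let ?e = "\<lambda>e a. (mix e (case_nat \<zero> (mix c d)))(1 := a)"
  \<comment> \<open>Variable 1 is the bound one; its slot in the parameter list
    \<open>case_nat \<zero> (mix c d)\<close> holds a dummy value. On \<open>u\<close>,
    \<open>mixr\<close> skips this slot and reads \<open>c\<close>; on \<open>p\<close>,
    \<open>mixr\<close> selects \<open>d\<close>, and \<open>unshift\<close> then makes argument 0
    read the bound variable.\<close>
  define r where "r = ExN 1 (Conj (Less (Var 1) (ren_tm mixr u)) (ren_fm unshift id (ren_fm mixr id p)))"
  have "1 \<notin> tm_vars (ren_tm mixr u)"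
  proof
    assume "1 \<in> tm_vars (ren_tm mixr u)"
    then obtain n where "1 = mixr n" unfolding tm_vars_ren_tm by (rule imageE)
    then show False by presburger
  qed
  then have "bounded_fm r"
    unfolding r_def by (intro bounded_fm.intros bounded_ren_fm p inj_unshift inj_mixr)
  moreover have "val M (?e e a) (ren_tm mixr u) = t e" for e a
    unfolding val_ren_tm mix_case_mixr u ..
  moreover have "sat M (?e e a) E (ren_fm unshift id (ren_fm mixr id p)) \<longleftrightarrow> Q e a" for e a
    unfolding sat_ren_fm[OF bounded_ren_fm[OF p(1) inj_mixr] inj_unshift] sat_ren_fm[OF p(1) inj_mixr]
      mix_unshift mix_mixr id_def p(3)[symmetric] by simp
  ultimately show ?thesis unfolding delta0_def using p(2)
    by (intro exI[of _ r] exI[of _ "case_nat \<zero> (mix c d)"] exI[of _ E])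
       (simp add: r_def del: fun_upd_apply, simp)
qed

lemma delta0_ball:
  assumes "term_fn t" "delta0 (\<lambda>e. Q (\<lambda>n. e (Suc n)) (e 0))"
  shows "delta0 (\<lambda>e. \<forall>x. x \<sqsubset> t e \<longrightarrow> Q e x)"
  using delta0_neg[OF delta0_bex[OF assms(1) delta0_neg[OF assms(2)]]] by simp

lemma delta0_const: "delta0 (\<lambda>e. P)"
  using delta0_eq[OF term_fn_const term_fn_const, of \<zero> \<zero>] delta0_neg[OF delta0_eq[OF term_fn_const term_fn_const, of \<zero> \<zero>]]
  by (cases P) simp_all

text \<open>Since \<open>k\<close> is an external number, the quantifier unfolds into a finite
  disjunction of formulas.\<close>

lemma delta0_fin_ex:
  assumes "\<And>i. i < (k::nat) \<Longrightarrow> delta0 (P i)"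
  shows "delta0 (\<lambda>e. \<exists>i<k. P i e)"
  using assms
proof (induction k)
  case (Suc k)
  then have "delta0 (\<lambda>e. (\<exists>i<k. P i e) \<or> P k e)" by (intro delta0_disj) auto
  then show ?case by (simp add: less_Suc_eq ex_disj_distrib conj_disj_distribR)
qed (simp add: delta0_const)

lemma delta0_fin_all:
  assumes "\<And>i. i < (k::nat) \<Longrightarrow> delta0 (P i)"
  shows "delta0 (\<lambda>e. \<forall>i<k. P i e)"
  using delta0_neg[OF delta0_fin_ex[of k "\<lambda>i e. \<not> P i e", OF delta0_neg[OF assms]]] by simp

lemmas term_fn_intros = term_fn_plus term_fn_times term_fn_pair term_fn_var term_fn_const
lemmas delta0_intros = delta0_conj delta0_disj delta0_imp delta0_iff delta0_neg delta0_bex delta0_ball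
  delta0_eq delta0_less delta0_mem

lemma sigma1_ex_delta0: "delta0 (\<lambda>e. Q (\<lambda>n. e (Suc n)) (e 0)) \<Longrightarrow> sigma1 (\<lambda>e. \<exists>x. Q e x)"
  unfolding sigma1_def by auto

lemma sigma1_delta0: "delta0 P \<Longrightarrow> sigma1 P"
  unfolding sigma1_def by (intro exI[of _ "\<lambda>e x. P e"]) (auto intro: delta0_ren)

lemma sigma1_fm:
  assumes "sigma1 P"
  obtains p c E where "bounded_fm p" "range E \<subseteq> set_domain M" "\<And>e. P e \<longleftrightarrow> sat M (mix e c) E (ExN 1 p)"
proof -
  from assms obtain Q where Q: "delta0 (\<lambda>e. Q (\<lambda>n. e (Suc n)) (e 0))" "P = (\<lambda>e. \<exists>x. Q e x)"
    unfolding sigma1_def by blast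
  from Q(1) obtain p d E where p: "bounded_fm p" "range E \<subseteq> set_domain M"
    "\<And>e. Q (\<lambda>n. e (Suc n)) (e 0) \<longleftrightarrow> sat M (mix e d) E p"
    unfolding delta0_def by metis
  have "P e \<longleftrightarrow> sat M (mix e (case_nat \<zero> d)) E (ExN 1 (ren_fm unshift id p))" for e
    unfolding Q(2) sat.simps sat_ren_fm[OF p(1) inj_unshift] mix_unshift id_def
    p(3)[symmetric] by simp
  then show ?thesis using that p(2) bounded_ren_fm[OF p(1) inj_unshift] by blast
qed

section \<open>Induction and comprehension for definable predicates\<close>

lemma mix_upd: "(mix e c)(2 * i := a) = mix (e(i := a)) c"
  by (auto simp: mix_def fun_eq_iff)

lemma sigma1_induct [consumes 1]:
  assumes "sigma1 (\<lambda>e. P (e 0))" "P \<zero>" "\<And>n. P n \<Longrightarrow> P (n \<oplus> \<one>)"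
  shows "P n"
proof -
  from assms(1) obtain p c E where p: "bounded_fm p" "range E \<subseteq> set_domain M"
    "\<And>e. P (e 0) \<longleftrightarrow> sat M (mix e c) E (ExN 1 p)"
    by (rule sigma1_fm) blast
  \<comment> \<open>Only argument 0 matters, so the other arguments are fixed at
    \<open>\<zero>\<close>; argument 0 is variable 0, the induction variable of the scheme.\<close>
  have *: "P n \<longleftrightarrow> sat M ((mix (\<lambda>_. \<zero>) c)(0 := n)) E (ExN 1 p)" for n
    using p(3)[of "(\<lambda>_. \<zero>)(0 := n)"] mix_upd[of "\<lambda>_. \<zero>" c 0 n] by simp
  have Sigma: "Sigma01 (ExN 1 p)" using p(1) by (auto simp: Sigma01_def)
  have "Sigma01_induction M" using model by (auto simp: RCA0_model_def)
  from this[unfolded Sigma01_induction_def, rule_format, OF Sigma p(2), of "mix (\<lambda>_. \<zero>) c" 0]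
  show ?thesis unfolding *[symmetric] using assms(2,3) by blast
qed

lemma delta0_induct [consumes 1]:
  assumes "delta0 (\<lambda>e. P (e 0))" "P \<zero>" "\<And>n. P n \<Longrightarrow> P (n \<oplus> \<one>)"
  shows "P n"
  using sigma1_delta0[OF assms(1)] assms(2,3) by (rule sigma1_induct)

text \<open>The scheme takes a single assignment for both of its formulas. Negating the matrix of
  the second predicate yields the \<open>Pi01\<close> formula, and \<open>delta0_merge\<close> pools
  the parameters.\<close>

lemma delta1_comprehension:
  assumes "sigma1 (\<lambda>e. P (e 0))" "sigma1 (\<lambda>e. \<not> P (e 0))"
  obtains X where "X \<in> set_domain M" "\<And>n. n \<in> X \<longleftrightarrow> P n"
proof -
  from assms(1) obtain Q where Q: "delta0 (\<lambda>e. Q (\<lambda>n. e (Suc n)) (e 0))" "\<And>e. P (e 0) = (\<exists>x. Q e x)"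
    unfolding sigma1_def fun_eq_iff by blast
  from assms(2) obtain Q' where Q': "delta0 (\<lambda>e. Q' (\<lambda>n. e (Suc n)) (e 0))" "\<And>e. (\<not> P (e 0)) = (\<exists>x. Q' e x)"
    unfolding sigma1_def fun_eq_iff by blast
  from Q(1) delta0_neg[OF Q'(1)] obtain p q d E where pq: "bounded_fm p" "bounded_fm q"
    "range E \<subseteq> set_domain M" "\<And>e. Q (\<lambda>n. e (Suc n)) (e 0) \<longleftrightarrow> sat M (mix e d) E p"
    "\<And>e. \<not> Q' (\<lambda>n. e (Suc n)) (e 0) \<longleftrightarrow> sat M (mix e d) E q"
    by (rule delta0_merge) blast
  let ?c = "case_nat \<zero> d"
  let ?p = "ExN 1 (ren_fm unshift id p)" and ?q = "AllN 1 (ren_fm unshift id q)"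
  have "sat M (mix e ?c) E ?p \<longleftrightarrow> P (e 0)" for e
    unfolding Q(2) sat.simps sat_ren_fm[OF pq(1) inj_unshift] mix_unshift id_def
    pq(4)[symmetric] by simp
  then have p: "sat M ((mix (\<lambda>_. \<zero>) ?c)(0 := n)) E ?p \<longleftrightarrow> P n" for n
    using mix_upd[of "\<lambda>_. \<zero>" ?c 0 n] by simp
  have "(\<forall>x. \<not> Q' e x) \<longleftrightarrow> P (e 0)" for e
    using Q'(2) by blast
  then have "sat M (mix e ?c) E ?q \<longleftrightarrow> P (e 0)" for e
    unfolding sat.simps sat_ren_fm[OF pq(2) inj_unshift] mix_unshift id_def
    pq(5)[symmetric] by simp
  then have q: "sat M ((mix (\<lambda>_. \<zero>) ?c)(0 := n)) E ?q \<longleftrightarrow> P n" for n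
    using mix_upd[of "\<lambda>_. \<zero>" ?c 0 n] by simp
  have pi: "Sigma01 ?p" "Pi01 ?q"
    using pq(1,2) by (auto simp: Sigma01_def Pi01_def intro: bounded_ren_fm inj_unshift)
  have "Delta01_comprehension M" using model by (auto simp: RCA0_model_def)
  from this[unfolded Delta01_comprehension_def, rule_format, OF pi pq(3), of "mix (\<lambda>_. \<zero>) ?c" 0]
  have "\<exists>X \<in> set_domain M. \<forall>n. n \<in> X \<longleftrightarrow> P n"
    unfolding p q by simp
  then show ?thesis using that by blast
qed

lemma delta0_comprehension:
  assumes "delta0 (\<lambda>e. P (e 0))"
  obtains X where "X \<in> set_domain M" "\<And>n. n \<in> X \<longleftrightarrow> P n"
  using delta1_comprehension[OF sigma1_delta0[OF assms] sigma1_delta0[OF delta0_neg[OF assms]]] by blast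

section \<open>Arithmetic in models of \<open>RCA\<^sub>0\<close>\<close>

lemma basic: "basic_axioms M"
  using model by (simp add: RCA0_model_def)

lemma succ_neq_zero: "n \<oplus> \<one> \<noteq> \<zero>"
  and succ_inject: "m \<oplus> \<one> = n \<oplus> \<one> \<longleftrightarrow> m = n"
  and add_zero: "m \<oplus> \<zero> = m"
  and add_succ: "m \<oplus> (n \<oplus> \<one>) = (m \<oplus> n) \<oplus> \<one>"
  and mult_zero: "m \<otimes> \<zero> = \<zero>"
  and mult_succ: "m \<otimes> (n \<oplus> \<one>) = (m \<otimes> n) \<oplus> m"
  and not_less_zero: "\<not> m \<sqsubset> \<zero>"
  and less_succ_iff: "m \<sqsubset> n \<oplus> \<one> \<longleftrightarrow> m \<sqsubset> n \<or> m = n"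
  using basic unfolding basic_axioms_def by blast+

section \<open>Semiring laws\<close>

lemma add_assoc: "(a \<oplus> b) \<oplus> c = a \<oplus> (b \<oplus> c)"
  by (rule delta0_induct[of "\<lambda>c. (a \<oplus> b) \<oplus> c = a \<oplus> (b \<oplus> c)"])
     (intro delta0_intros term_fn_intros, simp_all add: add_zero add_succ)

lemma zero_add: "\<zero> \<oplus> n = n"
  by (rule delta0_induct[of "\<lambda>n. \<zero> \<oplus> n = n"])
     (intro delta0_intros term_fn_intros, simp_all add: add_zero add_succ)

lemma succ_add: "(m \<oplus> \<one>) \<oplus> n = (m \<oplus> n) \<oplus> \<one>"
  by (rule delta0_induct[of "\<lambda>n. (m \<oplus> \<one>) \<oplus> n = (m \<oplus> n) \<oplus> \<one>"])
     (intro delta0_intros term_fn_intros, simp_all add: add_zero add_succ)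

lemma add_commute: "m \<oplus> n = n \<oplus> m"
  by (rule delta0_induct[of "\<lambda>n. m \<oplus> n = n \<oplus> m"])
     (intro delta0_intros term_fn_intros, simp_all add: add_zero add_succ zero_add succ_add)

lemma add_left_commute: "a \<oplus> (b \<oplus> c) = b \<oplus> (a \<oplus> c)"
  by (metis add_assoc add_commute)

lemmas add_ac = add_assoc add_commute add_left_commute

lemma add_right_cancel: "a \<oplus> c = b \<oplus> c \<longleftrightarrow> a = b"
  by (rule delta0_induct[of "\<lambda>c. a \<oplus> c = b \<oplus> c \<longleftrightarrow> a = b"])
     (intro delta0_intros term_fn_intros, simp_all add: add_zero add_succ succ_inject)

lemma add_left_cancel: "c \<oplus> a = c \<oplus> b \<longleftrightarrow> a = b"
  using add_right_cancel[of a c b] by (simp add: add_commute)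

lemma distrib_left: "a \<otimes> (b \<oplus> c) = a \<otimes> b \<oplus> a \<otimes> c"
  by (rule delta0_induct[of "\<lambda>c. a \<otimes> (b \<oplus> c) = a \<otimes> b \<oplus> a \<otimes> c"])
     (intro delta0_intros term_fn_intros, simp_all add: add_zero mult_zero mult_succ flip: add_assoc)

lemma zero_mult: "\<zero> \<otimes> n = \<zero>"
  by (rule delta0_induct[of "\<lambda>n. \<zero> \<otimes> n = \<zero>"])
     (intro delta0_intros term_fn_intros, simp_all add: add_zero mult_zero mult_succ)

lemma succ_mult: "(m \<oplus> \<one>) \<otimes> n = m \<otimes> n \<oplus> n"
  by (rule delta0_induct[of "\<lambda>n. (m \<oplus> \<one>) \<otimes> n = m \<otimes> n \<oplus> n"])
     (intro delta0_intros term_fn_intros, simp_all add: add_zero mult_zero mult_succ add_ac)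

lemma mult_commute: "m \<otimes> n = n \<otimes> m"
  by (rule delta0_induct[of "\<lambda>n. m \<otimes> n = n \<otimes> m"])
     (intro delta0_intros term_fn_intros, simp_all add: mult_zero zero_mult mult_succ succ_mult)

lemma distrib_right: "(b \<oplus> c) \<otimes> a = b \<otimes> a \<oplus> c \<otimes> a"
  by (simp add: mult_commute[of _ a] distrib_left)

lemma mult_one: "m \<otimes> \<one> = m"
  using mult_succ[of m \<zero>] by (simp add: mult_zero zero_add)

lemma mult_assoc: "(a \<otimes> b) \<otimes> c = a \<otimes> (b \<otimes> c)"
  by (rule delta0_induct[of "\<lambda>c. (a \<otimes> b) \<otimes> c = a \<otimes> (b \<otimes> c)"])
     (intro delta0_intros term_fn_intros, simp_all add: mult_zero mult_one distrib_left)

lemma mult_left_commute: "a \<otimes> (b \<otimes> c) = b \<otimes> (a \<otimes> c)"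
  by (metis mult_assoc mult_commute)

lemma one_mult: "\<one> \<otimes> m = m"
  by (simp add: mult_commute[of \<one>] mult_one)

lemmas semiring_simps = add_assoc add_commute add_left_commute mult_assoc mult_commute mult_left_commute
  distrib_left distrib_right mult_one one_mult add_zero zero_add mult_zero zero_mult

section \<open>The order\<close>

lemma zero_or_succ: "n = \<zero> \<or> (\<exists>m. n = m \<oplus> \<one>)"
proof -
  \<comment> \<open>The quantifier is pulled out of the disjunction to reach the shape required for
    \<open>sigma1\<close> induction.\<close>
  have "\<exists>m. n = \<zero> \<or> n = m \<oplus> \<one>"
    by (rule sigma1_induct[of "\<lambda>n. \<exists>m. n = \<zero> \<or> n = m \<oplus> \<one>"])
       (intro sigma1_ex_delta0 delta0_intros term_fn_intros, simp_all add: succ_inject)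
  then show ?thesis by blast
qed

lemma add_eq_zero: "a \<oplus> b = \<zero> \<longleftrightarrow> a = \<zero> \<and> b = \<zero>"
  using zero_or_succ[of b] by (auto simp: add_zero add_succ succ_neq_zero)

text \<open>The axioms treat the order as primitive; this reduces its theory to that of addition.
  The difference is written \<open>d \<oplus> \<one>\<close> to keep it nonzero.\<close>

lemma less_iff_add: "a \<sqsubset> b \<longleftrightarrow> (\<exists>d. b = a \<oplus> (d \<oplus> \<one>))"
proof
  have "\<exists>d. a \<sqsubset> b \<longrightarrow> b = a \<oplus> (d \<oplus> \<one>)"
  proof (rule sigma1_induct[of "\<lambda>b. \<exists>d. a \<sqsubset> b \<longrightarrow> b = a \<oplus> (d \<oplus> \<one>)"])
    show "\<exists>d. a \<sqsubset> n \<oplus> \<one> \<longrightarrow> n \<oplus> \<one> = a \<oplus> (d \<oplus> \<one>)" if "\<exists>d. a \<sqsubset> n \<longrightarrow> n = a \<oplus> (d \<oplus> \<one>)" for n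
      using that by (metis less_succ_iff add_succ add_zero)
  qed (intro sigma1_ex_delta0 delta0_intros term_fn_intros, simp add: not_less_zero)
  then show "a \<sqsubset> b \<Longrightarrow> \<exists>d. b = a \<oplus> (d \<oplus> \<one>)" by blast
next
  have "a \<sqsubset> a \<oplus> (d \<oplus> \<one>)" for d
    by (rule delta0_induct[of "\<lambda>d. a \<sqsubset> a \<oplus> (d \<oplus> \<one>)"])
       (intro delta0_intros term_fn_intros, simp_all add: add_succ add_zero less_succ_iff)
  then show "\<exists>d. b = a \<oplus> (d \<oplus> \<one>) \<Longrightarrow> a \<sqsubset> b" by blast
qed

definition le :: "'a \<Rightarrow> 'a \<Rightarrow> bool" (infix "\<sqsubseteq>" 50) where
  "a \<sqsubseteq> b \<longleftrightarrow> a \<sqsubset> b \<or> a = b"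

lemma le_iff_add: "a \<sqsubseteq> b \<longleftrightarrow> (\<exists>d. b = a \<oplus> d)"
  unfolding le_def less_iff_add by (metis add_zero zero_or_succ)

lemma delta0_le: "term_fn t \<Longrightarrow> term_fn u \<Longrightarrow> delta0 (\<lambda>e. t e \<sqsubseteq> u e)"
  unfolding le_def by (intro delta0_intros)

lemma less_linear: "a \<sqsubset> b \<or> a = b \<or> b \<sqsubset> a"
proof (rule delta0_induct[of "\<lambda>a. a \<sqsubset> b \<or> a = b \<or> b \<sqsubset> a"])
  show "\<zero> \<sqsubset> b \<or> \<zero> = b \<or> b \<sqsubset> \<zero>"
    using zero_or_succ[of b] less_iff_add[of \<zero>] by (auto simp: zero_add)
  show "n \<oplus> \<one> \<sqsubset> b \<or> n \<oplus> \<one> = b \<or> b \<sqsubset> n \<oplus> \<one>" if "n \<sqsubset> b \<or> n = b \<or> b \<sqsubset> n" for n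
  proof (cases "n \<sqsubset> b")
    case True
    then obtain d where "b = n \<oplus> (d \<oplus> \<one>)" unfolding less_iff_add by blast
    then have "n \<oplus> \<one> \<sqsubseteq> b" unfolding le_iff_add by (auto simp: add_ac)
    then show ?thesis by (auto simp: le_def)
  next
    case False
    then show ?thesis using that by (auto simp: less_succ_iff)
  qed
qed (intro delta0_intros term_fn_intros)

lemma less_irrefl: "\<not> a \<sqsubset> a"
  unfolding less_iff_add using add_left_cancel[of a \<zero>] succ_neq_zero by (metis add_zero)

lemma le_trans: "a \<sqsubseteq> b \<Longrightarrow> b \<sqsubseteq> c \<Longrightarrow> a \<sqsubseteq> c"
  unfolding le_iff_add by (auto simp: add_assoc)

lemma le_antisym: "a \<sqsubseteq> b \<Longrightarrow> b \<sqsubseteq> a \<Longrightarrow> a = b"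
  unfolding le_iff_add by (metis add_assoc add_left_cancel add_zero add_eq_zero)

sublocale N: linorder "(\<sqsubseteq>)" "(\<sqsubset>)"
proof
  show "x \<sqsubset> y \<longleftrightarrow> x \<sqsubseteq> y \<and> \<not> y \<sqsubseteq> x" for x y
    using le_antisym[of x y] less_irrefl unfolding le_def by blast
  show "x \<sqsubseteq> y \<or> y \<sqsubseteq> x" for x y
    using less_linear unfolding le_def by blast
qed (auto simp: le_def[of a a for a] intro: le_trans le_antisym)

lemma less_succ: "a \<sqsubset> b \<oplus> \<one> \<longleftrightarrow> a \<sqsubseteq> b"
  by (simp add: less_succ_iff le_def)

lemma succ_le: "a \<oplus> \<one> \<sqsubseteq> b \<longleftrightarrow> a \<sqsubset> b"
  unfolding less_iff_add le_iff_add by (simp add: add_ac)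

lemma zero_le: "\<zero> \<sqsubseteq> a"
  unfolding le_iff_add by (auto simp: zero_add)

lemma le_add1: "a \<sqsubseteq> a \<oplus> b" and le_add2: "a \<sqsubseteq> b \<oplus> a"
  unfolding le_iff_add by (auto simp: add_commute)

lemma succ_less_succ: "a \<oplus> \<one> \<sqsubset> b \<oplus> \<one> \<longleftrightarrow> a \<sqsubset> b"
  by (simp add: less_succ succ_le)

lemma mult_le_mono: "a \<sqsubseteq> b \<Longrightarrow> c \<sqsubseteq> d \<Longrightarrow> a \<otimes> c \<sqsubseteq> b \<otimes> d"
  unfolding le_iff_add by (auto simp: distrib_left distrib_right add_assoc)

lemma le_mult: "d \<noteq> \<zero> \<Longrightarrow> q \<sqsubseteq> q \<otimes> d"
  using zero_or_succ[of d] unfolding le_iff_add by (auto simp: mult_succ add_commute)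

text \<open>These bounds allow quantifiers over the components of coded objects to be replaced by
  bounded ones.\<close>

lemma le_pair1: "m \<sqsubseteq> pair M m n" and le_pair2: "n \<sqsubseteq> pair M m n"
proof -
  show "m \<sqsubseteq> pair M m n" unfolding pair_def by (rule le_add2)
  have "m \<oplus> n \<sqsubseteq> (m \<oplus> n) \<otimes> (m \<oplus> n)"
    using le_mult[of "m \<oplus> n" "m \<oplus> n"] by (cases "m \<oplus> n = \<zero>") (auto simp: zero_le)
  then show "n \<sqsubseteq> pair M m n" unfolding pair_def
    by (meson le_add1 le_add2 N.order_trans)
qed

text \<open>With s = m + n, the code of (m, n) lies in the block from s^2 up to but excluding (s +
  1)^2, and different sums give disjoint blocks.\<close>

lemma pair_less: "m \<oplus> n \<sqsubset> m' \<oplus> n' \<Longrightarrow> pair M m n \<sqsubset> pair M m' n'"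
proof -
  let ?s = "m \<oplus> n" and ?t = "m' \<oplus> n'"
  assume "?s \<sqsubset> ?t"
  then have "(?s \<oplus> \<one>) \<otimes> (?s \<oplus> \<one>) \<sqsubseteq> ?t \<otimes> ?t"
    by (intro mult_le_mono) (simp_all add: succ_le)
  also have "\<dots> \<sqsubseteq> pair M m' n'" unfolding pair_def by (rule le_add1)
  finally have 1: "(?s \<oplus> \<one>) \<otimes> (?s \<oplus> \<one>) \<sqsubseteq> pair M m' n'" .
  have "(?s \<oplus> \<one>) \<otimes> (?s \<oplus> \<one>) = pair M m n \<oplus> ((n \<oplus> ?s) \<oplus> \<one>)"
    unfolding pair_def by (simp add: semiring_simps)
  then have "pair M m n \<sqsubset> (?s \<oplus> \<one>) \<otimes> (?s \<oplus> \<one>)"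
    unfolding less_iff_add by blast
  then show ?thesis using 1 by (rule N.less_le_trans)
qed

text \<open>The block determines the sum; cancelling its square leaves the first component.\<close>

lemma pair_inject: "pair M m n = pair M m' n' \<longleftrightarrow> m = m' \<and> n = n'"
proof
  assume eq: "pair M m n = pair M m' n'"
  then have "m \<oplus> n = m' \<oplus> n'"
    using pair_less[of m n m' n'] pair_less[of m' n' m n] N.less_irrefl by (metis less_linear)
  then show "m = m' \<and> n = n'"
    using eq unfolding pair_def by (auto simp: add_left_cancel)
qed auto

section \<open>Substitution into definable predicates, closure of \<open>sigma1\<close>, least
  witnesses\<close>

lemma less_succ_self: "a \<sqsubset> a \<oplus> \<one>"
  by (simp add: less_succ)

text \<open>Instead of substituting syntactically, a bounded variable is forced to equal the
  term.\<close>

lemma delta0_subst1: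
  assumes "delta0 (\<lambda>e. P (e 0))" "term_fn t"
  shows "delta0 (\<lambda>e. P (t e))"
proof -
  have "delta0 (\<lambda>e. \<exists>x. x \<sqsubset> t e \<oplus> \<one> \<and> (x = t e \<and> P x))"
    by (intro delta0_intros term_fn_intros assms term_fn_ren[OF assms(2)])
  then show ?thesis by (simp add: less_succ_self cong: conj_cong)
qed

lemma delta0_subst2:
  assumes "delta0 (\<lambda>e. P (e 0) (e 1))" "term_fn t" "term_fn u"
  shows "delta0 (\<lambda>e. P (t e) (u e))"
proof -
  have "delta0 (\<lambda>e. \<exists>y. y \<sqsubset> u e \<oplus> \<one> \<and> (\<exists>x. x \<sqsubset> t e \<oplus> \<one> \<and> (x = t e \<and> y = u e \<and> P x y)))"
    using assms(1)
    by (intro delta0_intros term_fn_intros term_fn_ren[OF assms(2)] term_fn_ren[OF assms(3)]) simp_all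
  moreover have "(\<exists>y. y \<sqsubset> u e \<oplus> \<one> \<and> (\<exists>x. x \<sqsubset> t e \<oplus> \<one> \<and> (x = t e \<and> y = u e \<and> P x y))) \<longleftrightarrow> P (t e) (u e)" for e
    using less_succ_self by blast
  ultimately show ?thesis by simp
qed

text \<open>Two unbounded witnesses are contracted to one common bound \<open>z\<close> above
  both.\<close>

lemma sigma1_ex:
  assumes "sigma1 (\<lambda>e. Q (\<lambda>n. e (Suc n)) (e 0))"
  shows "sigma1 (\<lambda>e. \<exists>x. Q e x)"
proof -
  from assms obtain R where R: "delta0 (\<lambda>e. R (\<lambda>n. e (Suc n)) (e 0))"
    "\<And>e. Q (\<lambda>n. e (Suc n)) (e 0) = (\<exists>y. R e y)"
    unfolding sigma1_def fun_eq_iff by blast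
  \<comment> \<open>Slots 0 and 1 hold the witnesses \<open>y\<close> and \<open>x\<close>;
    \<open>f\<close> skips slot 2 to make room for the bound \<open>z\<close>. \<open>C e x\<close>
    is \<open>e\<close> with \<open>x\<close> prepended.\<close>
  define f where "f n = (if n < 2 then n else Suc n)" for n :: nat
  define C where "C e x n = (case n of 0 \<Rightarrow> x | Suc n \<Rightarrow> e n)" for e :: "nat \<Rightarrow> 'a" and x n
  have "inj f" by (rule injI) (auto simp: f_def split: if_splits)
  from delta0_ren[OF R(1) this]
  have "delta0 (\<lambda>e. R (C (\<lambda>n. e (Suc (Suc (Suc n)))) (e 1)) (e 0))"
  proof (rule back_subst[of delta0], intro ext)
    fix e :: "nat \<Rightarrow> 'a"
    have "(\<lambda>n. e (f (Suc n))) = C (\<lambda>n. e (Suc (Suc (Suc n)))) (e 1)"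
      by (auto simp: f_def C_def fun_eq_iff split: nat.split)
    then show "R (\<lambda>n. e (f (Suc n))) (e (f 0)) = R (C (\<lambda>n. e (Suc (Suc (Suc n)))) (e 1)) (e 0)"
      by (simp add: f_def)
  qed
  then have "sigma1 (\<lambda>e. \<exists>z. \<exists>x. x \<sqsubset> z \<and> (\<exists>y. y \<sqsubset> z \<and> R (C e x) y))"
    by (intro sigma1_ex_delta0 delta0_bex term_fn_var) simp
  moreover have "(\<exists>z. \<exists>x. x \<sqsubset> z \<and> (\<exists>y. y \<sqsubset> z \<and> R (C e x) y)) \<longleftrightarrow> (\<exists>x. Q e x)" for e
  proof -
    have "Q e x \<longleftrightarrow> (\<exists>y. R (C e x) y)" for x
      using R(2)[of "C e x"] by (simp add: C_def)
    moreover have "\<exists>z. x \<sqsubset> z \<and> y \<sqsubset> z" for x y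
      by (meson less_succ le_add1 le_add2)
    ultimately show ?thesis by metis
  qed
  ultimately show ?thesis by simp
qed

lemma sigma1_conj:
  assumes "sigma1 P" "sigma1 Q"
  shows "sigma1 (\<lambda>e. P e \<and> Q e)"
proof -
  from assms(1) obtain R where R: "delta0 (\<lambda>e. R (\<lambda>n. e (Suc n)) (e 0))" "P = (\<lambda>e. \<exists>x. R e x)"
    unfolding sigma1_def by blast
  from assms(2) obtain R' where R': "delta0 (\<lambda>e. R' (\<lambda>n. e (Suc n)) (e 0))" "Q = (\<lambda>e. \<exists>x. R' e x)"
    unfolding sigma1_def by blast
  have "delta0 (\<lambda>e. R (\<lambda>n. e (Suc (Suc n))) (e 1))"
    using delta0_ren[OF R(1), of Suc] by simp
  moreover have "delta0 (\<lambda>e. R' (\<lambda>n. e (Suc (Suc n))) (e 0))"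
    using delta0_ren[OF R'(1), of "\<lambda>n. if n = 0 then 0 else Suc n"] by (simp add: inj_def)
  ultimately have "sigma1 (\<lambda>e. \<exists>x. \<exists>y. R e x \<and> R' e y)"
    by (intro sigma1_ex sigma1_ex_delta0 delta0_conj) simp_all
  then show ?thesis by (simp add: R R')
qed

text \<open>Without a least witness, the bounded statement that nothing below \<open>n\<close>
  satisfies \<open>P\<close> would be inductive, hence true for all \<open>n\<close>.\<close>

lemma delta0_least:
  assumes "delta0 (\<lambda>e. P (e 0))" "P a"
  obtains b where "P b" "\<And>c. c \<sqsubset> b \<Longrightarrow> \<not> P c"
proof (rule ccontr)
  assume "\<not> thesis"
  then have *: "\<And>b. P b \<Longrightarrow> \<exists>c. c \<sqsubset> b \<and> P c" using that by blast
  have "delta0 (\<lambda>e. \<not> P (e 0))"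
    using assms(1) by (intro delta0_intros)
  then have D: "delta0 (\<lambda>e. \<forall>x. x \<sqsubset> e 0 \<longrightarrow> \<not> P x)"
    by (intro delta0_ball term_fn_intros)
  have "\<forall>x. x \<sqsubset> n \<longrightarrow> \<not> P x" for n
    using D by (rule delta0_induct) (use * in \<open>auto simp: not_less_zero less_succ_iff\<close>)
  then show False using assms(2) less_succ_self by blast
qed

section \<open>Coding finite sets and sequences\<close>

text \<open>For a nonzero divisor the quotient is at most \<open>n\<close>; for the divisor zero
  also \<open>n\<close> is zero, and any quotient will do.\<close>

lemma divides_bound: "divides M d n \<longleftrightarrow> (\<exists>q. q \<sqsubset> n \<oplus> \<one> \<and> n = q \<otimes> d)"
proof
  assume "divides M d n"
  then obtain q where q: "n = q \<otimes> d" unfolding divides_def by blast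
  show "\<exists>q. q \<sqsubset> n \<oplus> \<one> \<and> n = q \<otimes> d"
  proof (cases "d = \<zero>")
    case True
    then show ?thesis using q by (auto simp: mult_zero less_succ zero_le)
  next
    case False
    then show ?thesis using q le_mult[of d q] by (auto simp: less_succ)
  qed
qed (auto simp: divides_def)

lemma delta0_divides:
  assumes "term_fn t" "term_fn u"
  shows "delta0 (\<lambda>e. divides M (t e) (u e))"
  unfolding divides_bound
  by (intro delta0_intros term_fn_intros assms assms[THEN term_fn_ren])

lemma divides_mult: "divides M d a \<Longrightarrow> divides M d (a \<otimes> b)"
  and divides_mult': "divides M d a \<Longrightarrow> divides M d (b \<otimes> a)"
  unfolding divides_def by (metis mult_assoc mult_commute)+

lemma divides_self: "divides M d d"
  unfolding divides_def by (metis one_mult)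

text \<open>There is no subtraction, so the quotients of \<open>a\<close> and
  \<open>a \<oplus> b\<close> are compared. If the first is larger, \<open>b\<close> must be
  zero.\<close>

lemma divides_add_cancel:
  assumes "divides M d a" "divides M d (a \<oplus> b)"
  shows "divides M d b"
proof -
  obtain u v where u: "a = u \<otimes> d" and v: "a \<oplus> b = v \<otimes> d"
    using assms unfolding divides_def by blast
  show ?thesis
  proof (cases "u \<sqsubseteq> v")
    case True
    then obtain w where "v = u \<oplus> w" unfolding le_iff_add by blast
    then have "b = w \<otimes> d" using u v by (simp add: distrib_right add_left_cancel)
    then show ?thesis unfolding divides_def by blast
  next
    case False
    then obtain w where "u = v \<oplus> w" by (metis N.linear le_iff_add)
    then have "v \<otimes> d \<oplus> (w \<otimes> d \<oplus> b) = v \<otimes> d \<oplus> \<zero>"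
      using u v by (simp add: distrib_right add_assoc add_zero)
    then have "b = \<zero>" unfolding add_left_cancel by (simp add: add_eq_zero)
    then show ?thesis unfolding divides_def by (metis zero_mult)
  qed
qed

text \<open>
  The moduli \<open>m(i + 1) + 1\<close> for \<open>i < k\<close> are pairwise coprime when every positive number up to \<open>k\<close>
  divides \<open>m\<close>; coprimality is used in the form of Euclid's lemma.
\<close>

lemma moduli_coprime:
  assumes m: "\<And>i. i \<sqsubset> k \<Longrightarrow> divides M (i \<oplus> \<one>) m" and ij: "i \<sqsubset> k" "j \<sqsubset> k" "i \<noteq> j"
    and "divides M (m \<otimes> (i \<oplus> \<one>) \<oplus> \<one>) (n \<otimes> (m \<otimes> (j \<oplus> \<one>) \<oplus> \<one>))"
  shows "divides M (m \<otimes> (i \<oplus> \<one>) \<oplus> \<one>) n"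
proof -
  let ?a = "m \<otimes> (i \<oplus> \<one>) \<oplus> \<one>" and ?b = "m \<otimes> (j \<oplus> \<one>) \<oplus> \<one>"
  \<comment> \<open>The modulus is coprime to \<open>m\<close>: adding \<open>x\<close> to a
    multiple of \<open>x \<otimes> m\<close> gives \<open>x \<otimes> ?a\<close>.\<close>
  have cancel: "divides M ?a x" if "divides M ?a (x \<otimes> m)" for x
  proof (rule divides_add_cancel)
    show "divides M ?a (x \<otimes> m \<otimes> (i \<oplus> \<one>))" using that by (rule divides_mult)
    have "x \<otimes> m \<otimes> (i \<oplus> \<one>) \<oplus> x = x \<otimes> ?a" by (simp add: semiring_simps)
    then show "divides M ?a (x \<otimes> m \<otimes> (i \<oplus> \<one>) \<oplus> x)" by (simp add: divides_mult' divides_self)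
  qed
  \<comment> \<open>Two moduli differ by \<open>m \<otimes> (d \<oplus> \<one>)\<close>, where
    \<open>d \<oplus> \<one>\<close> is the distance between \<open>i\<close> and \<open>j\<close>;
    the sign of the difference separates the cases.\<close>
  obtain d where d: "d \<sqsubset> k" "divides M ?a (n \<otimes> (d \<oplus> \<one>) \<otimes> m)"
  proof -
    consider d where "j = i \<oplus> (d \<oplus> \<one>)" | d where "i = j \<oplus> (d \<oplus> \<one>)"
      using less_linear[of i j] ij(3) unfolding less_iff_add by blast
    then show ?thesis
    proof cases
      case 1
      have "n \<otimes> ?b = n \<otimes> ?a \<oplus> n \<otimes> (d \<oplus> \<one>) \<otimes> m" unfolding 1 by (simp add: semiring_simps)
      then have "divides M ?a (n \<otimes> (d \<oplus> \<one>) \<otimes> m)"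
        using assms(5) divides_add_cancel[of ?a "n \<otimes> ?a"] by (simp add: divides_mult' divides_self)
      moreover have "d \<sqsubset> j" unfolding 1 by (metis add_left_commute less_iff_add)
      ultimately show ?thesis using that ij N.less_trans by blast
    next
      case 2
      have "n \<otimes> ?a = n \<otimes> ?b \<oplus> n \<otimes> (d \<oplus> \<one>) \<otimes> m" unfolding 2 by (simp add: semiring_simps)
      then have "divides M ?a (n \<otimes> (d \<oplus> \<one>) \<otimes> m)"
        using assms(5) divides_add_cancel[of ?a "n \<otimes> ?b"] by (metis divides_mult' divides_self)
      moreover have "d \<sqsubset> i" unfolding 2 by (metis add_left_commute less_iff_add)
      ultimately show ?thesis using that ij N.less_trans by blast
    qed
  qed
  from d(2) have "divides M ?a (n \<otimes> (d \<oplus> \<one>))" by (rule cancel)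
  \<comment> \<open>As \<open>d \<oplus> \<one>\<close> divides \<open>m\<close>, the factor can be
    enlarged to \<open>m\<close>, which is then cancelled as well.\<close>
  moreover obtain q where "m = q \<otimes> (d \<oplus> \<one>)" using m[OF d(1)] unfolding divides_def by blast
  ultimately have "divides M ?a (n \<otimes> m)"
    using divides_mult'[of ?a "n \<otimes> (d \<oplus> \<one>)" q] by (metis mult_left_commute)
  then show ?thesis by (rule cancel)
qed

text \<open>The induction step multiplies by the new number, as for a factorial. That
  \<open>m\<close> is nonzero later makes all moduli exceed one.\<close>

lemma common_multiple: "\<exists>m. m \<noteq> \<zero> \<and> (\<forall>i. i \<sqsubset> k \<longrightarrow> divides M (i \<oplus> \<one>) m)"
proof (rule sigma1_induct[of "\<lambda>k. \<exists>m. m \<noteq> \<zero> \<and> (\<forall>i. i \<sqsubset> k \<longrightarrow> divides M (i \<oplus> \<one>) m)"])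
  show "\<exists>m. m \<noteq> \<zero> \<and> (\<forall>i. i \<sqsubset> \<zero> \<longrightarrow> divides M (i \<oplus> \<one>) m)"
    using succ_neq_zero[of \<zero>] by (auto simp: not_less_zero)
  show "\<exists>m. m \<noteq> \<zero> \<and> (\<forall>i. i \<sqsubset> n \<oplus> \<one> \<longrightarrow> divides M (i \<oplus> \<one>) m)"
    if IH: "\<exists>m. m \<noteq> \<zero> \<and> (\<forall>i. i \<sqsubset> n \<longrightarrow> divides M (i \<oplus> \<one>) m)" for n
  proof -
    obtain m where m: "m \<noteq> \<zero>" "\<And>i. i \<sqsubset> n \<Longrightarrow> divides M (i \<oplus> \<one>) m" using IH by blast
    then have "m \<otimes> (n \<oplus> \<one>) \<noteq> \<zero>" by (simp add: mult_succ add_eq_zero)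
    then show ?thesis using m
      by (auto simp: less_succ_iff intro!: exI[of _ "m \<otimes> (n \<oplus> \<one>)"] intro: divides_mult divides_mult' divides_self)
  qed
qed (intro sigma1_ex_delta0 delta0_intros delta0_divides term_fn_intros)

text \<open>The witness is the product of the moduli belonging to those \<open>i\<close> below
  \<open>l\<close> and \<open>k\<close> that satisfy \<open>P\<close>. It is built by induction on
  \<open>l\<close>; by Euclid's lemma a new factor affects divisibility only by its own
  modulus.\<close>

lemma moduli_product:
  assumes P: "delta0 (\<lambda>e. P (e 0))" and m: "m \<noteq> \<zero>" "\<And>i. i \<sqsubset> k \<Longrightarrow> divides M (i \<oplus> \<one>) m"
  shows "\<exists>n. \<forall>i. i \<sqsubset> k \<longrightarrow> (divides M (m \<otimes> (i \<oplus> \<one>) \<oplus> \<one>) n \<longleftrightarrow> i \<sqsubset> l \<and> P i)"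
proof (rule sigma1_induct[of "\<lambda>l. \<exists>n. \<forall>i. i \<sqsubset> k \<longrightarrow> (divides M (m \<otimes> (i \<oplus> \<one>) \<oplus> \<one>) n \<longleftrightarrow> i \<sqsubset> l \<and> P i)"])
  show "sigma1 (\<lambda>e. \<exists>n. \<forall>i. i \<sqsubset> k \<longrightarrow> (divides M (m \<otimes> (i \<oplus> \<one>) \<oplus> \<one>) n \<longleftrightarrow> i \<sqsubset> e 0 \<and> P i))"
    by (intro sigma1_ex_delta0 delta0_intros delta0_divides term_fn_intros delta0_subst1[of P, OF P])
  \<comment> \<open>The induction starts from the empty product \<open>\<one>\<close>, which no
    modulus divides.\<close>
  have "\<not> divides M (m \<otimes> (i \<oplus> \<one>) \<oplus> \<one>) \<one>" for i
  proof
    assume "divides M (m \<otimes> (i \<oplus> \<one>) \<oplus> \<one>) \<one>"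
    then obtain q where q: "\<one> = q \<otimes> (m \<otimes> (i \<oplus> \<one>) \<oplus> \<one>)" unfolding divides_def by blast
    have "q \<noteq> \<zero>" using q succ_neq_zero[of \<zero>] by (auto simp: zero_mult zero_add)
    then have "m \<otimes> (i \<oplus> \<one>) \<oplus> \<one> \<sqsubseteq> \<one>" using q le_mult[of q] by (metis mult_commute)
    then have "m \<otimes> (i \<oplus> \<one>) \<sqsubset> \<zero> \<oplus> \<one>"
      unfolding succ_le zero_add .
    then have "m \<otimes> (i \<oplus> \<one>) = \<zero>" by (simp add: less_succ_iff not_less_zero)
    then show False using m(1) by (simp add: mult_succ add_eq_zero)
  qed
  then show "\<exists>n. \<forall>i. i \<sqsubset> k \<longrightarrow> (divides M (m \<otimes> (i \<oplus> \<one>) \<oplus> \<one>) n \<longleftrightarrow> i \<sqsubset> \<zero> \<and> P i)"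
    by (auto simp: not_less_zero)
  show "\<exists>n. \<forall>i. i \<sqsubset> k \<longrightarrow> (divides M (m \<otimes> (i \<oplus> \<one>) \<oplus> \<one>) n \<longleftrightarrow> i \<sqsubset> l \<oplus> \<one> \<and> P i)"
    if IH: "\<exists>n. \<forall>i. i \<sqsubset> k \<longrightarrow> (divides M (m \<otimes> (i \<oplus> \<one>) \<oplus> \<one>) n \<longleftrightarrow> i \<sqsubset> l \<and> P i)" for l
  proof -
    obtain n where n: "\<And>i. i \<sqsubset> k \<Longrightarrow> divides M (m \<otimes> (i \<oplus> \<one>) \<oplus> \<one>) n \<longleftrightarrow> i \<sqsubset> l \<and> P i"
      using IH by blast
    show ?thesis
    proof (cases "l \<sqsubset> k \<and> P l")
      case True
      let ?n = "n \<otimes> (m \<otimes> (l \<oplus> \<one>) \<oplus> \<one>)"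
      have "divides M (m \<otimes> (i \<oplus> \<one>) \<oplus> \<one>) ?n \<longleftrightarrow> i \<sqsubset> l \<oplus> \<one> \<and> P i" if i: "i \<sqsubset> k" for i
      proof (cases "i = l")
        case True
        then show ?thesis using \<open>l \<sqsubset> k \<and> P l\<close> by (simp add: divides_mult' divides_self less_succ_self)
      next
        case False
        have "divides M (m \<otimes> (i \<oplus> \<one>) \<oplus> \<one>) ?n \<longleftrightarrow> divides M (m \<otimes> (i \<oplus> \<one>) \<oplus> \<one>) n"
          using moduli_coprime[OF m(2) i _ False] True divides_mult by blast
        then show ?thesis unfolding n[OF i] less_succ_iff using False by blast
      qed
      then show ?thesis by blast
    next
      case False
      then show ?thesis using n by (intro exI[of _ n]) (auto simp: less_succ_iff)
    qed
  qed
qed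

section \<open>Codes of finite sets\<close>

lemma elems_pair: "elems M (pair M k (pair M m n)) = {i. i \<sqsubset> k \<and> divides M (m \<otimes> (i \<oplus> \<one>) \<oplus> \<one>) n}"
  by (auto simp: elems_def pair_inject)

lemma mem_elems_iff:
  "i \<in> elems M c \<longleftrightarrow> (\<exists>k. k \<sqsubset> c \<oplus> \<one> \<and> (\<exists>m. m \<sqsubset> c \<oplus> \<one> \<and> (\<exists>n. n \<sqsubset> c \<oplus> \<one> \<and>
     c = pair M k (pair M m n) \<and> i \<sqsubset> k \<and> divides M (m \<otimes> (i \<oplus> \<one>) \<oplus> \<one>) n)))"
proof -
  have "k \<sqsubseteq> pair M k (pair M m n)" "m \<sqsubseteq> pair M k (pair M m n)" "n \<sqsubseteq> pair M k (pair M m n)" for k m n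
    using le_pair1 le_pair2 N.order_trans by metis+
  then show ?thesis unfolding elems_def less_succ by blast
qed

lemma delta0_elems:
  assumes "term_fn t" "term_fn u"
  shows "delta0 (\<lambda>e. t e \<in> elems M (u e))"
proof -
  have "delta0 (\<lambda>e. e 0 \<in> elems M (e 1))"
    unfolding mem_elems_iff by (intro delta0_intros delta0_divides term_fn_intros)
  then show ?thesis using assms by (rule delta0_subst2)
qed

lemma elems_less: "i \<in> elems M c \<Longrightarrow> i \<sqsubset> c"
  unfolding elems_def using le_pair1 N.less_le_trans by blast

lemma set_rep_bound: "set_rep M c \<longleftrightarrow> (\<exists>k. k \<sqsubset> c \<oplus> \<one> \<and> (\<exists>m. m \<sqsubset> c \<oplus> \<one> \<and> (\<exists>n. n \<sqsubset> c \<oplus> \<one> \<and>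
     c = pair M k (pair M m n))))"
proof -
  have "k \<sqsubseteq> pair M k (pair M m n)" "m \<sqsubseteq> pair M k (pair M m n)" "n \<sqsubseteq> pair M k (pair M m n)" for k m n
    using le_pair1 le_pair2 N.order_trans by metis+
  then show ?thesis unfolding set_rep_def less_succ by blast
qed

lemma delta0_set_rep:
  assumes "term_fn t"
  shows "delta0 (\<lambda>e. set_rep M (t e))"
proof -
  have "delta0 (\<lambda>e. set_rep M (e 0))"
    unfolding set_rep_bound by (intro delta0_intros term_fn_intros)
  then show ?thesis using assms by (rule delta0_subst1)
qed

lemma elems_eq_bound:
  "elems M c = elems M d \<longleftrightarrow> (\<forall>i. i \<sqsubset> c \<oplus> d \<longrightarrow> (i \<in> elems M c \<longleftrightarrow> i \<in> elems M d))"
proof -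
  have "i \<in> elems M c \<Longrightarrow> i \<sqsubset> c \<oplus> d" "i \<in> elems M d \<Longrightarrow> i \<sqsubset> c \<oplus> d" for i
    using elems_less le_add1 le_add2 N.less_le_trans by blast+
  then show ?thesis by blast
qed

lemma delta0_set_code:
  assumes "term_fn t"
  shows "delta0 (\<lambda>e. set_code M (t e))"
proof -
  have "delta0 (\<lambda>e. set_code M (e 0))"
    unfolding set_code_def elems_eq_bound by (intro delta0_intros delta0_set_rep delta0_elems term_fn_intros)
  then show ?thesis using assms by (rule delta0_subst1)
qed

lemma set_code_eq: "set_code M c \<Longrightarrow> set_code M d \<Longrightarrow> elems M c = elems M d \<Longrightarrow> c = d"
  unfolding set_code_def using less_linear by metis

text \<open>Bounded comprehension inside the numbers: \<open>moduli_product\<close> with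
  \<open>l\<close> equal to \<open>k\<close> gives some representative, and the least number
  principle turns it into the code.\<close>

lemma set_code_exists:
  assumes P: "delta0 (\<lambda>e. P (e 0))" and k: "\<And>i. P i \<Longrightarrow> i \<sqsubset> k"
  obtains c where "set_code M c" "elems M c = Collect P"
proof -
  obtain m where m: "m \<noteq> \<zero>" "\<And>i. i \<sqsubset> k \<Longrightarrow> divides M (i \<oplus> \<one>) m" using common_multiple by blast
  from moduli_product[OF P m, of k] obtain n
    where "\<And>i. i \<sqsubset> k \<Longrightarrow> divides M (m \<otimes> (i \<oplus> \<one>) \<oplus> \<one>) n \<longleftrightarrow> P i" by blast
  then have "elems M (pair M k (pair M m n)) = Collect P"
    unfolding elems_pair using k by blast
  moreover have "set_rep M (pair M k (pair M m n))" unfolding set_rep_def by blast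
  ultimately obtain d where d: "set_rep M d" "elems M d = Collect P" by blast
  have "delta0 (\<lambda>e. set_rep M (e 0) \<and> elems M (e 0) = elems M d)"
    unfolding elems_eq_bound by (intro delta0_intros delta0_set_rep delta0_elems term_fn_intros)
  moreover have "set_rep M d \<and> elems M d = elems M d" using d by blast
  ultimately obtain c where c: "set_rep M c \<and> elems M c = elems M d"
    "\<And>b. b \<sqsubset> c \<Longrightarrow> \<not> (set_rep M b \<and> elems M b = elems M d)"
    by (rule delta0_least[of "\<lambda>c. set_rep M c \<and> elems M c = elems M d"]) blast
  then have "set_code M c" unfolding set_code_def by blast
  then show ?thesis using c(1) d(2) that by blast
qed

section \<open>Finite sequences\<close>

lemma entry_bounds: "entry M s i x \<Longrightarrow> i \<sqsubset> s" "entry M s i x \<Longrightarrow> x \<sqsubset> s"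
  using elems_less le_pair1 le_pair2 N.le_less_trans by blast+

text \<open>Indices and entries lie below the code of the sequence, so every quantifier can be
  bounded by it.\<close>

lemma seq_of_length_iff:
  "seq_of_length M s l \<longleftrightarrow> set_code M s \<and>
     (\<forall>p. p \<sqsubset> s \<longrightarrow> p \<in> elems M s \<longrightarrow> (\<exists>i. i \<sqsubset> s \<and> (\<exists>x. x \<sqsubset> s \<and> p = pair M i x \<and> i \<sqsubset> l))) \<and>
     (\<forall>i. i \<sqsubset> l \<longrightarrow> (\<exists>x. x \<sqsubset> s \<and> entry M s i x \<and> (\<forall>y. y \<sqsubset> s \<longrightarrow> entry M s i y \<longrightarrow> y = x)))"
proof -
  have "(\<forall>p \<in> elems M s. \<exists>i x. p = pair M i x \<and> i \<sqsubset> l) \<longleftrightarrow>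
    (\<forall>p. p \<sqsubset> s \<longrightarrow> p \<in> elems M s \<longrightarrow> (\<exists>i. i \<sqsubset> s \<and> (\<exists>x. x \<sqsubset> s \<and> p = pair M i x \<and> i \<sqsubset> l)))"
    (is "?L \<longleftrightarrow> ?R")
  proof
    show ?R if ?L
    proof (intro allI impI)
      fix p assume "p \<in> elems M s"
      with \<open>?L\<close> obtain i x where "p = pair M i x" "i \<sqsubset> l" by blast
      moreover have "i \<sqsubset> s" "x \<sqsubset> s" using \<open>p \<in> elems M s\<close> entry_bounds calculation by auto
      ultimately show "\<exists>i. i \<sqsubset> s \<and> (\<exists>x. x \<sqsubset> s \<and> p = pair M i x \<and> i \<sqsubset> l)" by blast
    qed
    show ?L if ?R
      using that elems_less by meson
  qed
  moreover have "(\<exists>!x. entry M s i x) \<longleftrightarrow>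
    (\<exists>x. x \<sqsubset> s \<and> entry M s i x \<and> (\<forall>y. y \<sqsubset> s \<longrightarrow> entry M s i y \<longrightarrow> y = x))" for i
    using entry_bounds(2) by blast
  ultimately show ?thesis unfolding seq_of_length_def by simp
qed

lemma delta0_seq_of_length:
  assumes "term_fn t" "term_fn u"
  shows "delta0 (\<lambda>e. seq_of_length M (t e) (u e))"
proof -
  have "delta0 (\<lambda>e. seq_of_length M (e 0) (e 1))"
    unfolding seq_of_length_iff by (intro delta0_intros delta0_set_code delta0_elems term_fn_intros)
  then show ?thesis using assms by (rule delta0_subst2)
qed

lemma seq_entry_less: "seq_of_length M s l \<Longrightarrow> entry M s i x \<Longrightarrow> i \<sqsubset> l"
  unfolding seq_of_length_def by (metis pair_inject)

lemma seq_entry_ex: "seq_of_length M s l \<Longrightarrow> i \<sqsubset> l \<Longrightarrow> \<exists>x. entry M s i x"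
  unfolding seq_of_length_def by blast

lemma seq_entry_unique: "seq_of_length M s l \<Longrightarrow> entry M s i x \<Longrightarrow> entry M s i y \<Longrightarrow> x = y"
  using seq_entry_less unfolding seq_of_length_def by blast

text \<open>Otherwise the code would itself be the index of an entry, but indices lie below the
  code.\<close>

lemma seq_length_le: "seq_of_length M s l \<Longrightarrow> l \<sqsubseteq> s"
  by (metis seq_entry_ex entry_bounds(1) less_irrefl N.not_le)

lemma seq_length_unique: "seq_of_length M s l \<Longrightarrow> seq_of_length M s l' \<Longrightarrow> l = l'"
  using less_linear[of l l'] seq_entry_ex seq_entry_less N.less_irrefl by metis

text \<open>Codes are least representatives, so equal entries force equal codes. This makes
  sequence-valued definitions single-valued.\<close>

lemma seq_eqI:
  assumes "seq_of_length M s l" "seq_of_length M t l'" "\<And>i x. entry M s i x \<longleftrightarrow> entry M t i x"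
  shows "s = t"
proof (rule set_code_eq)
  show "set_code M s" "set_code M t" using assms unfolding seq_of_length_def by auto
  show "elems M s = elems M t"
    using assms unfolding seq_of_length_def by (metis (no_types) subsetI subset_antisym)
qed

lemma seq_empty: obtains s where "seq_of_length M s \<zero>"
proof -
  have "delta0 (\<lambda>e. e 0 \<sqsubset> \<zero>)" by (intro delta0_intros term_fn_intros)
  then obtain s where s: "set_code M s" "elems M s = Collect (\<lambda>x. x \<sqsubset> \<zero>)"
    by (rule set_code_exists) blast
  then have "seq_of_length M s \<zero>" unfolding seq_of_length_def by (simp add: not_less_zero)
  then show ?thesis by (rule that)
qed

lemma seq_append:
  assumes s: "seq_of_length M s l"
  obtains t where "seq_of_length M t (l \<oplus> \<one>)"
    "\<And>i y. entry M t i y \<longleftrightarrow> entry M s i y \<or> i = l \<and> y = x"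
proof -
  let ?P = "\<lambda>p. p \<in> elems M s \<or> p = pair M l x"
  have "delta0 (\<lambda>e. e 0 \<in> elems M s \<or> e 0 = pair M l x)"
    by (intro delta0_intros delta0_elems term_fn_intros)
  moreover have "p \<sqsubset> s \<oplus> (pair M l x \<oplus> \<one>)" if "?P p" for p
  proof -
    have "p \<sqsubset> s \<or> p \<sqsubset> pair M l x \<oplus> \<one>" using that elems_less less_succ_self by blast
    then show ?thesis using le_add1 le_add2 N.less_le_trans by blast
  qed
  ultimately obtain t where t: "set_code M t" "elems M t = Collect ?P"
    by (rule set_code_exists[of ?P]) blast
  then have *: "entry M t i y \<longleftrightarrow> entry M s i y \<or> i = l \<and> y = x" for i y
    by (simp add: pair_inject)
  have "seq_of_length M t (l \<oplus> \<one>)" unfolding seq_of_length_def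
  proof (intro conjI ballI allI impI)
    fix p assume "p \<in> elems M t"
    then show "\<exists>i x. p = pair M i x \<and> i \<sqsubset> l \<oplus> \<one>"
      using s t(2) unfolding seq_of_length_def less_succ_iff by blast
  next
    fix i assume i: "i \<sqsubset> l \<oplus> \<one>"
    show "\<exists>!x. entry M t i x"
    proof (cases "i = l")
      case True
      then have "\<not> entry M s i y" for y using seq_entry_less[OF s] N.less_irrefl by blast
      then show ?thesis unfolding * using True by blast
    next
      case False
      then show ?thesis unfolding * using i s seq_entry_less[OF s]
        unfolding seq_of_length_def less_succ_iff by blast
    qed
  qed fact
  then show ?thesis using * that by blast
qed

section \<open>Functions and dependent choice\<close>

lemma total_functionD:
  assumes "total_function M F"
  shows "F \<in> set_domain M" "\<exists>x. pair M n x \<in> F" "pair M n x \<in> F \<Longrightarrow> pair M n y \<in> F \<Longrightarrow> x = y"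
  using assms unfolding total_function_def by blast+

text \<open>Totality and uniqueness make a \<open>sigma1\<close> graph into a set of the model: a
  pair is outside the graph iff some other value is attained at its index.\<close>

lemma total_function_exists:
  assumes G: "sigma1 (\<lambda>e. G (e 0) (e 1))" and ex1: "\<And>n. \<exists>!x. G n x"
  obtains F where "total_function M F" "\<And>n x. pair M n x \<in> F \<longleftrightarrow> G n x"
proof -
  define P where "P p = (\<exists>x n. p = pair M n x \<and> G n x)" for p
  have "sigma1 (\<lambda>e. P (e 0))"
    unfolding P_def using G
    by (intro sigma1_ex sigma1_conj[OF sigma1_delta0[OF delta0_eq]] term_fn_intros) simp_all
  \<comment> \<open>If \<open>p\<close> is not a pair, the bounded clause is vacuous and any point
    of the graph serves as \<open>n\<close> and \<open>y\<close>.\<close>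
  moreover have neg: "(\<not> P p) = (\<exists>y n. G n y \<and> (\<forall>m. m \<sqsubset> p \<oplus> \<one> \<longrightarrow> (\<forall>x. x \<sqsubset> p \<oplus> \<one> \<longrightarrow> p = pair M m x \<longrightarrow> m = n \<and> x \<noteq> y)))" for p
  proof (cases "\<exists>m x. p = pair M m x")
    case True
    then obtain m x where p: "p = pair M m x" by blast
    then have "m \<sqsubset> p \<oplus> \<one>" "x \<sqsubset> p \<oplus> \<one>" by (simp_all add: less_succ le_pair1 le_pair2)
    then show ?thesis unfolding P_def p pair_inject using ex1[of m] by blast
  next
    case False
    then show ?thesis unfolding P_def using ex1[of \<zero>] by blast
  qed
  have "sigma1 (\<lambda>e. \<not> P (e 0))"
    unfolding neg using G
    by (intro sigma1_ex sigma1_conj[OF _ sigma1_delta0[OF delta0_ball]] delta0_intros term_fn_intros) simp_all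
  ultimately obtain F where F: "F \<in> set_domain M" "\<And>p. p \<in> F \<longleftrightarrow> P p"
    by (rule delta1_comprehension) blast
  then have *: "pair M n x \<in> F \<longleftrightarrow> G n x" for n x
    by (auto simp: P_def pair_inject)
  then have "total_function M F"
    unfolding total_function_def * using F ex1 unfolding P_def by blast
  then show ?thesis using * that by blast
qed

text \<open>Taking least successors makes the choice deterministic. Finite runs are then coded by
  sequences, exist by \<open>sigma1\<close> induction and agree with each other, so the limit
  function has a \<open>sigma1\<close> graph.\<close>

lemma dependent_choice:
  assumes A: "delta0 (\<lambda>e. A (e 0))" and G: "delta0 (\<lambda>e. G (e 0) (e 1))"
    and a: "A a" and step: "\<And>s. A s \<Longrightarrow> \<exists>t. A t \<and> G s t"
  obtains F where "total_function M F" "pair M \<zero> a \<in> F" "\<And>n x. pair M n x \<in> F \<Longrightarrow> A x"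
    "\<And>n x y. pair M n x \<in> F \<Longrightarrow> pair M (n \<oplus> \<one>) y \<in> F \<Longrightarrow> G x y"
proof -
  \<comment> \<open>\<open>T s t\<close> selects the least admissible successor \<open>t\<close>; as
    \<open>A\<close> and \<open>G\<close> are bounded, so is \<open>T\<close>.\<close>
  define T where "T s t \<longleftrightarrow> A t \<and> G s t \<and> (\<forall>u. u \<sqsubset> t \<longrightarrow> \<not> (A u \<and> G s u))" for s t
  have dA: "delta0 (\<lambda>e. A (t e))" if "term_fn t" for t
    using A that by (rule delta0_subst1)
  have dG: "delta0 (\<lambda>e. G (t e) (u e))" if "term_fn t" "term_fn u" for t u
    using G that by (rule delta0_subst2)
  have dT: "delta0 (\<lambda>e. T (t e) (u e))" if "term_fn t" "term_fn u" for t u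
  proof -
    have "delta0 (\<lambda>e. T (e 0) (e 1))"
      unfolding T_def by (intro delta0_intros dA dG term_fn_intros)
    then show ?thesis using that by (rule delta0_subst2)
  qed
  have T_ex: "\<exists>t. T s t" if "A s" for s
  proof -
    obtain t where "A t \<and> G s t" using step \<open>A s\<close> by blast
    moreover have "delta0 (\<lambda>e. A (e 0) \<and> G s (e 0))"
      by (intro delta0_intros dA dG term_fn_intros)
    ultimately show ?thesis unfolding T_def
      using delta0_least[of "\<lambda>t. A t \<and> G s t"] by metis
  qed
  have T_unique: "t = u" if "T s t" "T s u" for s t u
    using that less_linear[of t u] unfolding T_def by blast

  \<comment> \<open>A run of \<open>n\<close> steps from \<open>a\<close> has
    \<open>n \<oplus> \<one>\<close> entries; the bounds by \<open>c\<close> on \<open>x\<close> and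
    \<open>y\<close> keep the predicate bounded.\<close>
  define C where "C c n \<longleftrightarrow> seq_of_length M c (n \<oplus> \<one>) \<and> entry M c \<zero> a \<and>
    (\<forall>i. i \<sqsubset> n \<longrightarrow> (\<forall>x. x \<sqsubset> c \<longrightarrow> (\<forall>y. y \<sqsubset> c \<longrightarrow> entry M c i x \<longrightarrow> entry M c (i \<oplus> \<one>) y \<longrightarrow> T x y)))" for c n
  have dC: "delta0 (\<lambda>e. C (t e) (u e))" if "term_fn t" "term_fn u" for t u
  proof -
    have "delta0 (\<lambda>e. C (e 0) (e 1))"
      unfolding C_def by (intro delta0_intros dT delta0_elems delta0_seq_of_length term_fn_intros)
    then show ?thesis using that by (rule delta0_subst2)
  qed
  have C_step: "T x y" if "C c n" "i \<sqsubset> n" "entry M c i x" "entry M c (i \<oplus> \<one>) y" for c n i x y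
    using that entry_bounds(2) unfolding C_def by blast
  have C_pred: "\<exists>x. entry M c i x \<and> T x y" if "C c n" "entry M c (i \<oplus> \<one>) y" for c n i y
  proof -
    have s: "seq_of_length M c (n \<oplus> \<one>)" using that(1) unfolding C_def by blast
    from seq_entry_less[OF s that(2)] have i: "i \<sqsubset> n" by (simp add: succ_less_succ)
    then have "i \<sqsubset> n \<oplus> \<one>" by (simp add: less_succ_iff)
    from seq_entry_ex[OF s this] C_step[OF that(1) i _ that(2)] show ?thesis by blast
  qed
  have C_zero: "x = a" if "C c n" "entry M c \<zero> x" for c n x
    using that seq_entry_unique unfolding C_def by blast
  have C_A: "A x" if c: "C c n" and x: "entry M c i x" for c n i x
  proof -
    \<comment> \<open>The induction serves as a case split: the entry at \<open>\<zero>\<close> is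
      \<open>a\<close>, and any later one is a \<open>T\<close>-successor, which satisfies
      \<open>A\<close> by definition.\<close>
    have "\<forall>x. x \<sqsubset> c \<longrightarrow> entry M c i x \<longrightarrow> A x"
    proof (rule delta0_induct[of "\<lambda>i. \<forall>x. x \<sqsubset> c \<longrightarrow> entry M c i x \<longrightarrow> A x"])
      show "\<forall>x. x \<sqsubset> c \<longrightarrow> entry M c \<zero> x \<longrightarrow> A x" using C_zero[OF c] a by blast
      show "\<forall>x. x \<sqsubset> c \<longrightarrow> entry M c (i \<oplus> \<one>) x \<longrightarrow> A x" for i
        using C_pred[OF c] unfolding T_def by blast
    qed (intro delta0_intros delta0_elems dA term_fn_intros)
    then show ?thesis using x entry_bounds(2) by blast
  qed
  have C_unique: "x = y" if c: "C c n" and d: "C d m" and xy: "entry M c i x" "entry M d i y" for c d n m i x y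
  proof -
    have "\<forall>x. x \<sqsubset> c \<longrightarrow> (\<forall>y. y \<sqsubset> d \<longrightarrow> entry M c i x \<longrightarrow> entry M d i y \<longrightarrow> x = y)"
    proof (rule delta0_induct[of "\<lambda>i. \<forall>x. x \<sqsubset> c \<longrightarrow> (\<forall>y. y \<sqsubset> d \<longrightarrow> entry M c i x \<longrightarrow> entry M d i y \<longrightarrow> x = y)"])
      show "\<forall>x. x \<sqsubset> c \<longrightarrow> (\<forall>y. y \<sqsubset> d \<longrightarrow> entry M c \<zero> x \<longrightarrow> entry M d \<zero> y \<longrightarrow> x = y)"
        using C_zero[OF c] C_zero[OF d] by blast
      fix i
      assume IH: "\<forall>x. x \<sqsubset> c \<longrightarrow> (\<forall>y. y \<sqsubset> d \<longrightarrow> entry M c i x \<longrightarrow> entry M d i y \<longrightarrow> x = y)"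
      show "\<forall>x. x \<sqsubset> c \<longrightarrow> (\<forall>y. y \<sqsubset> d \<longrightarrow> entry M c (i \<oplus> \<one>) x \<longrightarrow> entry M d (i \<oplus> \<one>) y \<longrightarrow> x = y)"
      proof (intro allI impI)
        fix x y assume "entry M c (i \<oplus> \<one>) x" "entry M d (i \<oplus> \<one>) y"
        then obtain x' y' where "entry M c i x'" "T x' x" "entry M d i y'" "T y' y"
          using C_pred[OF c] C_pred[OF d] by blast
        moreover from this have "x' = y'" using IH entry_bounds(2) by blast
        ultimately show "x = y" using T_unique by blast
      qed
    qed (intro delta0_intros delta0_elems term_fn_intros)
    then show ?thesis using xy entry_bounds(2) by blast
  qed
  \<comment> \<open>A run can always be extended, because its last entry satisfies \<open>A\<close>
    and so has a \<open>T\<close>-successor.\<close>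
  have C_ex: "\<exists>c. C c n" for n
  proof (rule sigma1_induct[of "\<lambda>n. \<exists>c. C c n"])
    obtain s where s: "seq_of_length M s \<zero>" by (rule seq_empty)
    then obtain t where t: "seq_of_length M t (\<zero> \<oplus> \<one>)" "\<And>i y. entry M t i y \<longleftrightarrow> entry M s i y \<or> i = \<zero> \<and> y = a"
      by (rule seq_append) blast
    then show "\<exists>c. C c \<zero>" unfolding C_def by (auto simp: not_less_zero intro!: exI[of _ t])
    fix n assume "\<exists>c. C c n"
    then obtain c where c: "C c n" by blast
    then have s: "seq_of_length M c (n \<oplus> \<one>)" unfolding C_def by blast
    obtain x where x: "entry M c n x" using seq_entry_ex[OF s less_succ_self] by blast
    obtain y where y: "T x y" using T_ex[OF C_A[OF c x]] by blast
    obtain t where t: "seq_of_length M t (n \<oplus> \<one> \<oplus> \<one>)"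
      "\<And>i z. entry M t i z \<longleftrightarrow> entry M c i z \<or> i = n \<oplus> \<one> \<and> z = y"
      using seq_append[OF s] by blast
    have "T u v" if i: "i \<sqsubset> n \<oplus> \<one>" and uv: "entry M t i u" "entry M t (i \<oplus> \<one>) v" for i u v
    proof -
      have u: "entry M c i u" using uv(1) i less_irrefl unfolding t by blast
      show ?thesis
      proof (cases "i = n")
        case True
        then have "u = x" using u x seq_entry_unique[OF s] by blast
        moreover have "\<not> entry M c (n \<oplus> \<one>) v" using seq_entry_less[OF s] less_irrefl by blast
        then have "v = y" using uv(2) unfolding t True by blast
        ultimately show ?thesis using y by blast
      next
        case False
        then have "i \<sqsubset> n" using i by (simp add: less_succ_iff)
        moreover have "entry M c (i \<oplus> \<one>) v" using uv(2) False unfolding t succ_inject by blast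
        ultimately show ?thesis using C_step[OF c _ u] by blast
      qed
    qed
    moreover have "entry M t \<zero> a" using c unfolding C_def t by blast
    ultimately have "C t (n \<oplus> \<one>)" using t(1) unfolding C_def by blast
    then show "\<exists>c. C c (n \<oplus> \<one>)" by blast
  qed (intro sigma1_ex_delta0 dC term_fn_intros)

  \<comment> \<open>The value at \<open>n\<close> is the last entry of any run of \<open>n\<close>
    steps; \<open>C_unique\<close> makes it independent of the run.\<close>
  define K where "K n x = (\<exists>c. C c n \<and> entry M c n x)" for n x
  have "sigma1 (\<lambda>e. K (e 0) (e 1))"
    unfolding K_def by (intro sigma1_ex_delta0 delta0_intros dC delta0_elems term_fn_intros)
  moreover have "\<exists>!x. K n x" for n
  proof -
    obtain c where c: "C c n" using C_ex by blast
    then have "seq_of_length M c (n \<oplus> \<one>)" unfolding C_def by blast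
    then obtain x where "entry M c n x" using seq_entry_ex[OF _ less_succ_self] by blast
    then show ?thesis unfolding K_def using c C_unique by blast
  qed
  ultimately obtain F where F: "total_function M F" "\<And>n x. pair M n x \<in> F \<longleftrightarrow> K n x"
    by (rule total_function_exists) blast
  show ?thesis
  proof
    show "total_function M F" by fact
    show "pair M \<zero> a \<in> F" using C_ex[of \<zero>] unfolding F K_def by (auto simp: C_def)
    show "A x" if "pair M n x \<in> F" for n x using that C_A unfolding F K_def by blast
    show "G x y" if xy: "pair M n x \<in> F" "pair M (n \<oplus> \<one>) y \<in> F" for n x y
    proof -
      obtain c where c: "C c n" "entry M c n x" using xy(1) unfolding F K_def by blast
      obtain d where d: "C d (n \<oplus> \<one>)" "entry M d (n \<oplus> \<one>) y" using xy(2) unfolding F K_def by blast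
      obtain z where "entry M d n z" "T z y" using C_pred[OF d] by blast
      then show ?thesis using C_unique[OF c(1) d(1) c(2)] unfolding T_def by blast
    qed
  qed
qed

section \<open>\<open>H\<close>-well-foundedness\<close>

lemma H_of_iff:
  "s \<in> H_of M S R \<longleftrightarrow> (\<exists>l. l \<sqsubset> s \<oplus> \<one> \<and> seq_of_length M s l \<and>
     (\<forall>i. i \<sqsubset> s \<longrightarrow> (\<forall>x. x \<sqsubset> s \<longrightarrow> entry M s i x \<longrightarrow> x \<in> S)) \<and>
     (\<forall>i. i \<sqsubset> s \<longrightarrow> (\<forall>j. j \<sqsubset> s \<longrightarrow> (\<forall>x. x \<sqsubset> s \<longrightarrow> (\<forall>y. y \<sqsubset> s \<longrightarrow>
        i \<sqsubset> j \<longrightarrow> j \<sqsubset> l \<longrightarrow> entry M s i x \<longrightarrow> entry M s j y \<longrightarrow> pair M y x \<in> R)))))"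
proof -
  have 1: "(\<forall>i x. entry M s i x \<longrightarrow> x \<in> S) \<longleftrightarrow>
    (\<forall>i. i \<sqsubset> s \<longrightarrow> (\<forall>x. x \<sqsubset> s \<longrightarrow> entry M s i x \<longrightarrow> x \<in> S))"
    using entry_bounds by blast
  have 2: "(\<forall>i j x y. i \<sqsubset> j \<longrightarrow> j \<sqsubset> l \<longrightarrow> entry M s i x \<longrightarrow> entry M s j y \<longrightarrow> pair M y x \<in> R) \<longleftrightarrow>
    (\<forall>i. i \<sqsubset> s \<longrightarrow> (\<forall>j. j \<sqsubset> s \<longrightarrow> (\<forall>x. x \<sqsubset> s \<longrightarrow> (\<forall>y. y \<sqsubset> s \<longrightarrow>
        i \<sqsubset> j \<longrightarrow> j \<sqsubset> l \<longrightarrow> entry M s i x \<longrightarrow> entry M s j y \<longrightarrow> pair M y x \<in> R))))" for l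
    by (meson entry_bounds)
  show ?thesis unfolding H_of_def mem_Collect_eq less_succ 1 2 using seq_length_le by blast
qed

lemma delta0_H_of:
  assumes "term_fn t" "S \<in> set_domain M" "R \<in> set_domain M"
  shows "delta0 (\<lambda>e. t e \<in> H_of M S R)"
proof -
  have "delta0 (\<lambda>e. e 0 \<in> H_of M S R)"
    unfolding H_of_iff by (intro delta0_intros delta0_elems delta0_seq_of_length term_fn_intros assms(2,3))
  then show ?thesis using assms(1) by (rule delta0_subst1)
qed

lemma extends_iff:
  "extends M t s \<longleftrightarrow> (\<exists>l. l \<sqsubset> s \<oplus> \<one> \<and> seq_of_length M s l \<and> seq_of_length M t (l \<oplus> \<one>) \<and>
     (\<forall>i. i \<sqsubset> l \<longrightarrow> (\<forall>x. x \<sqsubset> t \<oplus> s \<longrightarrow> (entry M t i x \<longleftrightarrow> entry M s i x))))"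
proof -
  have "entry M t i x \<Longrightarrow> x \<sqsubset> t \<oplus> s" "entry M s i x \<Longrightarrow> x \<sqsubset> t \<oplus> s" for i x
    using entry_bounds(2) le_add1 le_add2 N.less_le_trans by blast+
  then show ?thesis unfolding extends_def less_succ by (metis seq_length_le)
qed

lemma delta0_extends:
  assumes "term_fn t" "term_fn u"
  shows "delta0 (\<lambda>e. extends M (t e) (u e))"
proof -
  have "delta0 (\<lambda>e. extends M (e 0) (e 1))"
    unfolding extends_iff by (intro delta0_intros delta0_elems delta0_seq_of_length term_fn_intros)
  then show ?thesis using assms by (rule delta0_subst2)
qed

section \<open>Chains of sequences and descending sequences of numbers\<close>

definition chain :: "'a set \<Rightarrow> bool" where
  "chain F \<longleftrightarrow> total_function M F \<and>
     (\<forall>n s t. pair M n s \<in> F \<longrightarrow> pair M (n \<oplus> \<one>) t \<in> F \<longrightarrow> extends M t s)"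

text \<open>A chain may start with a nonempty sequence, so the length of its \<open>n\<close>-th
  member is only bounded from below.\<close>

lemma chain_length:
  assumes F: "chain F" and s: "pair M n s \<in> F"
  obtains l where "seq_of_length M s l" "n \<sqsubseteq> l"
proof -
  have tot: "total_function M F" using F unfolding chain_def by blast
  have "\<exists>s l. pair M n s \<in> F \<and> seq_of_length M s l \<and> n \<sqsubseteq> l"
  proof (rule sigma1_induct[of "\<lambda>n. \<exists>s l. pair M n s \<in> F \<and> seq_of_length M s l \<and> n \<sqsubseteq> l"])
    show "sigma1 (\<lambda>e. \<exists>s l. pair M (e 0) s \<in> F \<and> seq_of_length M s l \<and> e 0 \<sqsubseteq> l)"
      by (intro sigma1_ex sigma1_delta0 delta0_intros delta0_le delta0_seq_of_length term_fn_intros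
          total_functionD(1)[OF tot])
    \<comment> \<open>The first member is known to be a sequence only because the second one extends
      it.\<close>
    obtain s t where "pair M \<zero> s \<in> F" "pair M (\<zero> \<oplus> \<one>) t \<in> F" using total_functionD(2)[OF tot] by blast
    moreover from this have "extends M t s" using F unfolding chain_def by blast
    ultimately show "\<exists>s l. pair M \<zero> s \<in> F \<and> seq_of_length M s l \<and> \<zero> \<sqsubseteq> l"
      unfolding extends_def using zero_le by blast
    fix n assume "\<exists>s l. pair M n s \<in> F \<and> seq_of_length M s l \<and> n \<sqsubseteq> l"
    then obtain s l where s: "pair M n s \<in> F" "seq_of_length M s l" "n \<sqsubseteq> l" by blast
    obtain t where t: "pair M (n \<oplus> \<one>) t \<in> F" using total_functionD(2)[OF tot] by blast
    then have "extends M t s" using F s(1) unfolding chain_def by blast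
    then have "seq_of_length M t (l \<oplus> \<one>)" unfolding extends_def using seq_length_unique[OF s(2)] by blast
    moreover have "n \<oplus> \<one> \<sqsubseteq> l \<oplus> \<one>" using s(3) by (simp add: succ_le less_succ)
    ultimately show "\<exists>t l. pair M (n \<oplus> \<one>) t \<in> F \<and> seq_of_length M t l \<and> n \<oplus> \<one> \<sqsubseteq> l" using t by blast
  qed
  then show ?thesis using that total_functionD(3)[OF tot s] by blast
qed

text \<open>By induction on the distance \<open>d\<close> between the positions: one extension
  preserves all earlier entries.\<close>

lemma chain_entry:
  assumes F: "chain F" and s: "pair M m s \<in> F" "pair M m' s' \<in> F" and "m \<sqsubseteq> m'" and x: "entry M s n x"
  shows "entry M s' n x"
proof -
  have tot: "total_function M F" using F unfolding chain_def by blast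
  have "\<exists>t. pair M (m \<oplus> d) t \<in> F \<and> entry M t n x" for d
  proof (rule sigma1_induct[of "\<lambda>d. \<exists>t. pair M (m \<oplus> d) t \<in> F \<and> entry M t n x"])
    show "\<exists>t. pair M (m \<oplus> \<zero>) t \<in> F \<and> entry M t n x" using s x by (auto simp: add_zero)
    fix d assume "\<exists>t. pair M (m \<oplus> d) t \<in> F \<and> entry M t n x"
    then obtain t where t: "pair M (m \<oplus> d) t \<in> F" "entry M t n x" by blast
    obtain u where u: "pair M (m \<oplus> d \<oplus> \<one>) u \<in> F" using total_functionD(2)[OF tot] by blast
    then have "extends M u t" using F t unfolding chain_def by blast
    then have "entry M u n x" unfolding extends_def using t(2) seq_entry_less by blast
    then show "\<exists>t. pair M (m \<oplus> (d \<oplus> \<one>)) t \<in> F \<and> entry M t n x" using u by (auto simp: add_assoc)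
  qed (intro sigma1_ex_delta0 delta0_intros delta0_elems term_fn_intros total_functionD(1)[OF tot])
  moreover obtain d where "m' = m \<oplus> d" using \<open>m \<sqsubseteq> m'\<close> unfolding le_iff_add by blast
  ultimately show ?thesis using total_functionD(3)[OF tot s(2)] by blast
qed

text \<open>All pairs of indices are compared, not only consecutive ones, because \<open>R\<close>
  need not be transitive.\<close>

definition descending :: "'a set \<Rightarrow> 'a set \<Rightarrow> 'a set \<Rightarrow> bool" where
  "descending S R a \<longleftrightarrow> total_function M a \<and> (\<forall>n x. pair M n x \<in> a \<longrightarrow> x \<in> S) \<and>
     (\<forall>m n x y. m \<sqsubset> n \<longrightarrow> pair M m x \<in> a \<longrightarrow> pair M n y \<in> a \<longrightarrow> pair M y x \<in> R)"

lemma H_wf_iff_chain: "H_wf M S R \<longleftrightarrow> \<not> (\<exists>F. chain F \<and> (\<forall>n s. pair M n s \<in> F \<longrightarrow> s \<in> H_of M S R))"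
  unfolding H_wf_def chain_def by blast

lemma chain_imp_descending:
  assumes F: "chain F" and H: "\<And>n s. pair M n s \<in> F \<Longrightarrow> s \<in> H_of M S R"
  obtains a where "descending S R a"
proof -
  have tot: "total_function M F" using F unfolding chain_def by blast
  \<comment> \<open>The \<open>n\<close>-th value is read off at position
    \<open>n \<oplus> \<one>\<close> of the chain, where the sequence is long enough to have an
    entry at \<open>n\<close>.\<close>
  define G where "G n x = (\<exists>s. pair M (n \<oplus> \<one>) s \<in> F \<and> entry M s n x)" for n x
  have "sigma1 (\<lambda>e. G (e 0) (e 1))"
    unfolding G_def by (intro sigma1_ex_delta0 delta0_intros delta0_elems term_fn_intros total_functionD(1)[OF tot])
  moreover have "\<exists>!x. G n x" for n
  proof -
    obtain s where s: "pair M (n \<oplus> \<one>) s \<in> F" using total_functionD(2)[OF tot] by blast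
    then obtain l where l: "seq_of_length M s l" "n \<oplus> \<one> \<sqsubseteq> l" using chain_length[OF F] by blast
    then have "\<exists>x. entry M s n x" by (intro seq_entry_ex) (auto simp: succ_le)
    then obtain x where x: "entry M s n x" by blast
    have "y = x" if "G n y" for y
      using that s x seq_entry_unique[OF l(1)] total_functionD(3)[OF tot] unfolding G_def by blast
    then show ?thesis using s x unfolding G_def by blast
  qed
  ultimately obtain a where a: "total_function M a" "\<And>n x. pair M n x \<in> a \<longleftrightarrow> G n x"
    by (rule total_function_exists) blast
  have "descending S R a"
    unfolding descending_def
  proof (intro conjI allI impI)
    fix n x assume "pair M n x \<in> a"
    then show "x \<in> S" using H unfolding a G_def H_of_def by blast
  next
    fix m n x y assume mn: "m \<sqsubset> n" and x: "pair M m x \<in> a" and y: "pair M n y \<in> a"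
    obtain s where s: "pair M (m \<oplus> \<one>) s \<in> F" "entry M s m x" using x unfolding a G_def by blast
    obtain t where t: "pair M (n \<oplus> \<one>) t \<in> F" "entry M t n y" using y unfolding a G_def by blast
    have "m \<oplus> \<one> \<sqsubseteq> n \<oplus> \<one>" using mn by (simp add: succ_le less_succ N.less_imp_le)
    then have "entry M t m x" using chain_entry[OF F s(1) t(1) _ s(2)] by blast
    moreover obtain l where l: "seq_of_length M t l"
      "\<And>i j x y. i \<sqsubset> j \<Longrightarrow> j \<sqsubset> l \<Longrightarrow> entry M t i x \<Longrightarrow> entry M t j y \<Longrightarrow> pair M y x \<in> R"
      using H[OF t(1)] unfolding H_of_def by blast
    ultimately show "pair M y x \<in> R" using mn t(2) seq_entry_less[OF l(1) t(2)] by blast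
  qed fact
  then show ?thesis by (rule that)
qed

lemma descending_imp_chain:
  assumes a: "descending S R a"
  obtains F where "chain F" "\<And>n s. pair M n s \<in> F \<Longrightarrow> s \<in> H_of M S R"
proof -
  have tot: "total_function M a" using a unfolding descending_def by blast
  \<comment> \<open>\<open>G n s\<close> says that \<open>s\<close> codes the initial segment of
    \<open>a\<close> of length \<open>n\<close>; the chain consists of these segments.\<close>
  define G where "G n s \<longleftrightarrow> seq_of_length M s n \<and> (\<forall>i. i \<sqsubset> n \<longrightarrow> (\<forall>x. x \<sqsubset> s \<longrightarrow> entry M s i x \<longrightarrow> pair M i x \<in> a))" for n s
  have G_seq: "seq_of_length M s n" if "G n s" for n s using that unfolding G_def by blast
  have G_entry: "entry M s i x \<longleftrightarrow> i \<sqsubset> n \<and> pair M i x \<in> a" if G: "G n s" for n s i x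
  proof
    assume e: "entry M s i x"
    then show "i \<sqsubset> n \<and> pair M i x \<in> a"
      using G seq_entry_less[OF G_seq[OF G] e] entry_bounds(2)[OF e] unfolding G_def by blast
  next
    assume i: "i \<sqsubset> n \<and> pair M i x \<in> a"
    then obtain y where y: "entry M s i y" using seq_entry_ex[OF G_seq[OF G]] by blast
    then have "pair M i y \<in> a" using G i entry_bounds(2)[OF y] unfolding G_def by blast
    then show "entry M s i x" using y i total_functionD(3)[OF tot] by blast
  qed
  have d: "delta0 (\<lambda>e. G (e 0) (e 1))"
    unfolding G_def by (intro delta0_intros delta0_elems delta0_seq_of_length term_fn_intros total_functionD(1)[OF tot])
  have "\<exists>s. G n s" for n
  proof (rule sigma1_induct[of "\<lambda>n. \<exists>s. G n s"])
    show "sigma1 (\<lambda>e. \<exists>s. G (e 0) s)"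
      by (intro sigma1_ex_delta0 delta0_subst2[of G, OF d] term_fn_intros)
    show "\<exists>s. G \<zero> s" using seq_empty not_less_zero unfolding G_def by metis
    fix n assume "\<exists>s. G n s"
    then obtain s where s: "G n s" by blast
    obtain x where x: "pair M n x \<in> a" using total_functionD(2)[OF tot] by blast
    obtain t where t: "seq_of_length M t (n \<oplus> \<one>)" "\<And>i y. entry M t i y \<longleftrightarrow> entry M s i y \<or> i = n \<and> y = x"
      using seq_append[OF G_seq[OF s]] by blast
    then have "G (n \<oplus> \<one>) t" unfolding G_def using x G_entry[OF s] by blast
    then show "\<exists>t. G (n \<oplus> \<one>) t" by blast
  qed
  moreover have "s = t" if "G n s" "G n t" for n s t
    using seq_eqI[OF G_seq G_seq, OF that] G_entry[OF that(1)] G_entry[OF that(2)] by blast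
  ultimately have "\<exists>!s. G n s" for n by blast
  with sigma1_delta0[OF d] obtain F where F: "total_function M F" "\<And>n x. pair M n x \<in> F \<longleftrightarrow> G n x"
    by (rule total_function_exists) blast
  have "extends M t s" if "G n s" "G (n \<oplus> \<one>) t" for n s t
    unfolding extends_def
    using that[THEN G_seq] G_entry[OF that(1)] G_entry[OF that(2)] less_succ_iff by blast
  then have "chain F" unfolding chain_def using F by blast
  moreover have "s \<in> H_of M S R" if "pair M n s \<in> F" for n s
  proof -
    have s: "G n s" using that F by blast
    have "x \<in> S" if "entry M s i x" for i x
      using that G_entry[OF s] a unfolding descending_def by blast
    moreover have "pair M y x \<in> R" if "i \<sqsubset> j" "entry M s i x" "entry M s j y" for i j x y
      using that G_entry[OF s] a unfolding descending_def by blast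
    ultimately show ?thesis unfolding H_of_def using G_seq[OF s] by blast
  qed
  ultimately show ?thesis by (rule that)
qed

lemma H_wf_iff_descending: "H_wf M S R \<longleftrightarrow> \<not> (\<exists>a. descending S R a)"
  unfolding H_wf_iff_chain by (metis chain_imp_descending descending_imp_chain)

lemma ind_H_wf_iff:
  assumes dom: "S \<in> set_domain M" "R \<in> set_domain M"
  shows "ind_H_wf M S R \<longleftrightarrow> H_wf M S R"
proof
  assume ind: "ind_H_wf M S R"
  show "H_wf M S R" unfolding H_wf_iff_chain
  proof
    assume "\<exists>F. chain F \<and> (\<forall>n s. pair M n s \<in> F \<longrightarrow> s \<in> H_of M S R)"
    then obtain F where F: "chain F" "\<And>n s. pair M n s \<in> F \<Longrightarrow> s \<in> H_of M S R" by blast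
    have tot: "total_function M F" using F unfolding chain_def by blast
    \<comment> \<open>The range of the chain is bounded-definable: the position of a member is at
      most its length, which is at most its code. Hence the complement of the chain is a set of the
      model.\<close>
    have "delta0 (\<lambda>e. e 0 \<in> H_of M S R \<and> \<not> (\<exists>n. n \<sqsubset> e 0 \<oplus> \<one> \<and> pair M n (e 0) \<in> F))"
      by (intro delta0_intros delta0_H_of term_fn_intros dom total_functionD(1)[OF tot])
    then obtain X where X: "X \<in> set_domain M"
      "\<And>s. s \<in> X \<longleftrightarrow> s \<in> H_of M S R \<and> \<not> (\<exists>n. n \<sqsubset> s \<oplus> \<one> \<and> pair M n s \<in> F)"
      by (rule delta0_comprehension) blast
    have "n \<sqsubset> s \<oplus> \<one>" if ns: "pair M n s \<in> F" for n s
    proof -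
      obtain l where "seq_of_length M s l" "n \<sqsubseteq> l" using chain_length[OF F(1) ns] .
      then show ?thesis unfolding less_succ using seq_length_le le_trans by blast
    qed
    then have X': "s \<in> X \<longleftrightarrow> s \<in> H_of M S R \<and> \<not> (\<exists>n. pair M n s \<in> F)" for s
      unfolding X by blast
    have "X = H_of M S R"
    proof (rule ind[unfolded ind_H_wf_def, rule_format, OF X(1)])
      show "X \<subseteq> H_of M S R" using X by blast
      fix y assume y: "y \<in> H_of M S R" "\<And>z. z \<in> H_of M S R \<Longrightarrow> extends M z y \<Longrightarrow> z \<in> X"
      have "pair M n y \<notin> F" for n
      proof
        assume n: "pair M n y \<in> F"
        obtain t where t: "pair M (n \<oplus> \<one>) t \<in> F" using total_functionD(2)[OF tot] by blast
        then have "extends M t y" using n F(1) unfolding chain_def by blast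
        then have "t \<in> X" using y(2) F(2)[OF t] by blast
        then show False using t unfolding X' by blast
      qed
      then show "y \<in> X" unfolding X' using y(1) by blast
    qed
    then show False using total_functionD(2)[OF tot] F(2) X' by blast
  qed
next
  assume wf: "H_wf M S R"
  show "ind_H_wf M S R" unfolding ind_H_wf_def
  proof (intro ballI impI)
    fix X assume X: "X \<in> set_domain M" "X \<subseteq> H_of M S R"
      and prog: "\<forall>y\<in>H_of M S R. (\<forall>z\<in>H_of M S R. extends M z y \<longrightarrow> z \<in> X) \<longrightarrow> y \<in> X"
    show "X = H_of M S R"
    proof (rule ccontr)
      assume "X \<noteq> H_of M S R"
      then obtain s where s: "s \<in> H_of M S R \<and> s \<notin> X" using X(2) by blast
      \<comment> \<open>Progressivity gives every member of \<open>H_of M S R\<close> outside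
        \<open>X\<close> an extension outside \<open>X\<close>, which is the step of the dependent
        choice.\<close>
      have "delta0 (\<lambda>e. e 0 \<in> H_of M S R \<and> e 0 \<notin> X)" "delta0 (\<lambda>e. extends M (e 1) (e 0))"
        by (intro delta0_intros delta0_H_of delta0_extends term_fn_intros dom X)+
      from dependent_choice[of "\<lambda>s. s \<in> H_of M S R \<and> s \<notin> X" "\<lambda>s t. extends M t s", OF this s]
      obtain F where "total_function M F" "\<And>n x. pair M n x \<in> F \<Longrightarrow> x \<in> H_of M S R \<and> x \<notin> X"
        "\<And>n x y. pair M n x \<in> F \<Longrightarrow> pair M (n \<oplus> \<one>) y \<in> F \<Longrightarrow> extends M y x"
        using prog by metis
      then show False using wf unfolding H_wf_def by blast
    qed
  qed
qed

section \<open>The equivalences\<close>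

lemma relation_on_dom: "relation_on M S R \<Longrightarrow> R \<in> set_domain M"
  unfolding relation_on_def by blast

lemma Union_dom:
  fixes R :: "nat \<Rightarrow> 'a set"
  assumes "\<And>i. i < k \<Longrightarrow> R i \<in> set_domain M"
  shows "(\<Union>i<k. R i) \<in> set_domain M"
proof -
  have "delta0 (\<lambda>e. \<exists>i<k. e 0 \<in> R i)"
    using assms by (intro delta0_fin_ex delta0_mem term_fn_intros)
  then obtain X where X: "X \<in> set_domain M" "\<And>n. n \<in> X \<longleftrightarrow> (\<exists>i<k. n \<in> R i)"
    by (rule delta0_comprehension) blast
  then have "(\<Union>i<k. R i) = X" by auto
  then show ?thesis using X(1) by simp
qed

text \<open>The two notions agree for each relation of the model; \<open>Union_dom\<close> ensures
  that the union is one.\<close>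

lemma union_ind_iff_union: "union_ind_H_wf M k \<longleftrightarrow> union_H_wf M k"
proof -
  have "(\<forall>i<k. relation_on M S (R i) \<and> ind_H_wf M S (R i)) \<longleftrightarrow> (\<forall>i<k. relation_on M S (R i) \<and> H_wf M S (R i))"
    if "S \<in> set_domain M" for S and R :: "nat \<Rightarrow> 'a set"
    using ind_H_wf_iff[OF that] relation_on_dom by blast
  moreover have "ind_H_wf M S (\<Union>i<k. R i) \<longleftrightarrow> H_wf M S (\<Union>i<k. R i)"
    if "S \<in> set_domain M" "\<forall>i<k. relation_on M S (R i) \<and> H_wf M S (R i)" for S and R :: "nat \<Rightarrow> 'a set"
    using ind_H_wf_iff[OF that(1) Union_dom, of k R] that(2) relation_on_dom by blast
  ultimately show ?thesis unfolding union_ind_H_wf_def union_H_wf_def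
    by (intro ball_cong refl all_cong1) metis
qed

text \<open>Even in a nonstandard model only standard numbers lie below a standard numeral, so the
  colours correspond to external indices.\<close>

lemma less_numeral_of: "c \<sqsubset> numeral_of M k \<longleftrightarrow> (\<exists>i<k. c = numeral_of M i)"
  by (induction k) (auto simp: not_less_zero less_succ_iff less_Suc_eq)

lemma numeral_of_less: "i < k \<Longrightarrow> numeral_of M i \<sqsubset> numeral_of M k"
  unfolding less_numeral_of by blast

lemma numeral_of_inject: "numeral_of M i = numeral_of M j \<longleftrightarrow> i = j"
  using numeral_of_less[of i j] numeral_of_less[of j i] less_irrefl by (metis linorder_neqE_nat)

section \<open>Increasing sequences and infinite sets\<close>

lemma strictly_increasing:
  assumes tot: "total_function M b"
    and step: "\<And>n x y. pair M n x \<in> b \<Longrightarrow> pair M (n \<oplus> \<one>) y \<in> b \<Longrightarrow> x \<sqsubset> y"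
    and "m \<sqsubset> n" and x: "pair M m x \<in> b" and y: "pair M n y \<in> b"
  shows "x \<sqsubset> y"
proof -
  have "\<exists>y. pair M (m \<oplus> (d \<oplus> \<one>)) y \<in> b \<and> x \<sqsubset> y" for d
  proof (rule sigma1_induct[of "\<lambda>d. \<exists>y. pair M (m \<oplus> (d \<oplus> \<one>)) y \<in> b \<and> x \<sqsubset> y"])
    show "\<exists>y. pair M (m \<oplus> (\<zero> \<oplus> \<one>)) y \<in> b \<and> x \<sqsubset> y"
      unfolding zero_add using step[OF x] total_functionD(2)[OF tot] by blast
    fix d assume "\<exists>y. pair M (m \<oplus> (d \<oplus> \<one>)) y \<in> b \<and> x \<sqsubset> y"
    then obtain y where y: "pair M (m \<oplus> (d \<oplus> \<one>)) y \<in> b" "x \<sqsubset> y" by blast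
    obtain z where z: "pair M (m \<oplus> (d \<oplus> \<one>) \<oplus> \<one>) z \<in> b" using total_functionD(2)[OF tot] by blast
    then have "x \<sqsubset> z" using step[OF y(1)] y(2) N.less_trans by blast
    then show "\<exists>y. pair M (m \<oplus> (d \<oplus> \<one> \<oplus> \<one>)) y \<in> b \<and> x \<sqsubset> y" using z by (auto simp: add_succ)
  qed (intro sigma1_ex_delta0 delta0_intros term_fn_intros total_functionD(1)[OF tot])
  moreover obtain d where "n = m \<oplus> (d \<oplus> \<one>)" using \<open>m \<sqsubset> n\<close> unfolding less_iff_add by blast
  ultimately show ?thesis using total_functionD(3)[OF tot y] by blast
qed

text \<open>Bounds the index by the value, which makes the range of an increasing sequence
  bounded-definable and unbounded in the model.\<close>

lemma strictly_increasing_ge: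
  assumes tot: "total_function M b"
    and step: "\<And>n x y. pair M n x \<in> b \<Longrightarrow> pair M (n \<oplus> \<one>) y \<in> b \<Longrightarrow> x \<sqsubset> y"
    and x: "pair M n x \<in> b"
  shows "n \<sqsubseteq> x"
proof -
  have "\<exists>x. pair M n x \<in> b \<and> n \<sqsubseteq> x"
  proof (rule sigma1_induct[of "\<lambda>n. \<exists>x. pair M n x \<in> b \<and> n \<sqsubseteq> x"])
    show "\<exists>x. pair M \<zero> x \<in> b \<and> \<zero> \<sqsubseteq> x" using total_functionD(2)[OF tot] zero_le by blast
    fix n assume "\<exists>x. pair M n x \<in> b \<and> n \<sqsubseteq> x"
    then obtain x where x: "pair M n x \<in> b" "n \<sqsubseteq> x" by blast
    obtain y where y: "pair M (n \<oplus> \<one>) y \<in> b" using total_functionD(2)[OF tot] by blast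
    then have "n \<oplus> \<one> \<sqsubseteq> y" using step[OF x(1)] x(2) unfolding succ_le by (metis N.le_less_trans)
    then show "\<exists>x. pair M (n \<oplus> \<one>) x \<in> b \<and> n \<oplus> \<one> \<sqsubseteq> x" using y by blast
  qed (intro sigma1_ex_delta0 delta0_intros delta0_le term_fn_intros total_functionD(1)[OF tot])
  then show ?thesis using total_functionD(3)[OF tot x] by blast
qed

text \<open>Dependent choice repeatedly picks a larger element of \<open>A\<close>, starting
  anywhere in \<open>A\<close>.\<close>

lemma infinite_set_enumeration:
  assumes A: "infinite_set M A"
  obtains b where "total_function M b" "\<And>n x. pair M n x \<in> b \<Longrightarrow> x \<in> A"
    "\<And>m n x y. m \<sqsubset> n \<Longrightarrow> pair M m x \<in> b \<Longrightarrow> pair M n y \<in> b \<Longrightarrow> x \<sqsubset> y"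
proof -
  have dom: "A \<in> set_domain M" and inf: "\<And>n. \<exists>m \<in> A. n \<sqsubset> m"
    using A unfolding infinite_set_def by auto
  obtain a where a: "a \<in> A" using inf by blast
  have d: "delta0 (\<lambda>e. e 0 \<in> A)" "delta0 (\<lambda>e. e 0 \<sqsubset> e 1)"
    by (intro delta0_intros term_fn_intros dom)+
  have "\<exists>t. t \<in> A \<and> s \<sqsubset> t" for s using inf by blast
  with d a obtain b where b: "total_function M b" "\<And>n x. pair M n x \<in> b \<Longrightarrow> x \<in> A"
    "\<And>n x y. pair M n x \<in> b \<Longrightarrow> pair M (n \<oplus> \<one>) y \<in> b \<Longrightarrow> x \<sqsubset> y"
    by (rule dependent_choice[of "\<lambda>x. x \<in> A" "(\<sqsubset>)"]) blast
  show ?thesis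
    using b(1,2) strictly_increasing[OF b(1,3)] by (rule that)
qed

text \<open>Pulls \<open>R\<close> back along \<open>a\<close> to indices. Values of
  \<open>a\<close> exist and are unique, so both the predicate and its negation can be stated
  existentially.\<close>

lemma descending_pairs_set:
  assumes tot: "total_function M a" and R: "R \<in> set_domain M"
  obtains Q where "Q \<in> set_domain M"
    "\<And>x y. pair M x y \<in> Q \<longleftrightarrow> (\<exists>u v. pair M x u \<in> a \<and> pair M y v \<in> a \<and> pair M v u \<in> R)"
proof -
  \<comment> \<open>Numbers that are not pairs satisfy \<open>P\<close> vacuously; only the pairs in
    \<open>Q\<close> are ever looked at.\<close>
  define P where "P p = (\<exists>u v. \<forall>x. x \<sqsubset> p \<oplus> \<one> \<longrightarrow> (\<forall>y. y \<sqsubset> p \<oplus> \<one> \<longrightarrow> p = pair M x y \<longrightarrow>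
    pair M x u \<in> a \<and> pair M y v \<in> a \<and> pair M v u \<in> R))" for p
  note dom = R total_functionD(1)[OF tot]
  have "sigma1 (\<lambda>e. P (e 0))" unfolding P_def
    by (intro sigma1_ex sigma1_delta0 delta0_intros term_fn_intros dom)
  moreover have neg: "(\<not> P p) = (\<exists>x y u v. p = pair M x y \<and> pair M x u \<in> a \<and> pair M y v \<in> a \<and> pair M v u \<notin> R)" for p
  proof (cases "\<exists>x y. p = pair M x y")
    case True
    then obtain x y where p: "p = pair M x y" by blast
    then have "x \<sqsubset> p \<oplus> \<one>" "y \<sqsubset> p \<oplus> \<one>" by (simp_all add: less_succ le_pair1 le_pair2)
    then have "P p \<longleftrightarrow> (\<exists>u v. pair M x u \<in> a \<and> pair M y v \<in> a \<and> pair M v u \<in> R)"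
      unfolding P_def p pair_inject by blast
    moreover obtain u v where "pair M x u \<in> a" "pair M y v \<in> a" using total_functionD(2)[OF tot] by blast
    ultimately show ?thesis unfolding p pair_inject using total_functionD(3)[OF tot] by metis
  next
    case False
    then show ?thesis unfolding P_def by blast
  qed
  have "sigma1 (\<lambda>e. \<not> P (e 0))" unfolding neg
    by (intro sigma1_ex sigma1_delta0 delta0_intros term_fn_intros dom)
  ultimately obtain Q where Q: "Q \<in> set_domain M" "\<And>p. p \<in> Q \<longleftrightarrow> P p"
    by (rule delta1_comprehension) blast
  have "pair M x y \<in> Q \<longleftrightarrow> (\<exists>u v. pair M x u \<in> a \<and> pair M y v \<in> a \<and> pair M v u \<in> R)" for x y
  proof -
    have "x \<sqsubset> pair M x y \<oplus> \<one>" "y \<sqsubset> pair M x y \<oplus> \<one>" by (simp_all add: less_succ le_pair1 le_pair2)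
    then show ?thesis unfolding Q P_def pair_inject by blast
  qed
  with Q(1) show ?thesis by (rule that)
qed

text \<open>A pair is coloured with the least index of a set \<open>Q i\<close> containing it, which
  resolves overlaps between these sets.\<close>

lemma colouring_exists:
  fixes Q :: "nat \<Rightarrow> 'a set"
  assumes dom: "\<And>i. i < k \<Longrightarrow> Q i \<in> set_domain M"
    and cover: "\<And>x y. x \<sqsubset> y \<Longrightarrow> \<exists>i<k. pair M x y \<in> Q i"
  shows "\<exists>P. colouring M k P \<and>
    (\<forall>x y c. pair M (pair M x y) c \<in> P \<longrightarrow> (\<exists>i<k. c = numeral_of M i \<and> pair M x y \<in> Q i))"
proof -
  define C where "C p c = (\<exists>i<k. c = numeral_of M i \<and> p \<in> Q i \<and> (\<forall>j<i. p \<notin> Q j))" for p c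
  have "delta0 (\<lambda>e. C (e 0) (e 1))"
    unfolding C_def
    by (intro delta0_fin_ex delta0_fin_all delta0_conj delta0_neg delta0_eq delta0_mem term_fn_intros dom) auto
  then have dC: "delta0 (\<lambda>e. C (t e) (u e))" if "term_fn t" "term_fn u" for t u
    using that by (rule delta0_subst2)
  let ?P = "\<lambda>p. \<exists>x. x \<sqsubset> p \<oplus> \<one> \<and> (\<exists>y. y \<sqsubset> p \<oplus> \<one> \<and> (\<exists>c. c \<sqsubset> p \<oplus> \<one> \<and>
    p = pair M (pair M x y) c \<and> x \<sqsubset> y \<and> C (pair M x y) c))"
  have "delta0 (\<lambda>e. ?P (e 0))"
    by (intro delta0_intros dC term_fn_intros)
  then obtain P where P: "P \<in> set_domain M" "\<And>p. p \<in> P \<longleftrightarrow> ?P p"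
    by (rule delta0_comprehension) blast
  have mem: "pair M (pair M x y) c \<in> P \<longleftrightarrow> x \<sqsubset> y \<and> C (pair M x y) c" for x y c
  proof -
    have "x \<sqsubset> pair M (pair M x y) c \<oplus> \<one>" "y \<sqsubset> pair M (pair M x y) c \<oplus> \<one>" "c \<sqsubset> pair M (pair M x y) c \<oplus> \<one>"
      unfolding less_succ using le_pair1 le_pair2 le_trans by blast+
    then show ?thesis unfolding P pair_inject by blast
  qed
  have "\<exists>!c. C p c" if ex: "\<exists>i<k. p \<in> Q i" for p
  proof -
    let ?i = "LEAST i. p \<in> Q i"
    obtain i where i: "i < k" "p \<in> Q i" using ex by blast
    have "?i < k" "p \<in> Q ?i" "\<forall>j<?i. p \<notin> Q j"
      using i LeastI[of "\<lambda>i. p \<in> Q i"] Least_le[of "\<lambda>i. p \<in> Q i" i] not_less_Least by force+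
    then have "C p (numeral_of M ?i)" unfolding C_def by blast
    moreover have "c = d" if "C p c" "C p d" for c d
      using that unfolding C_def by (metis linorder_neqE_nat)
    ultimately show ?thesis by blast
  qed
  then have "\<forall>x y. x \<sqsubset> y \<longrightarrow> (\<exists>!c. pair M (pair M x y) c \<in> P)"
    unfolding mem using cover by blast
  moreover have "\<forall>p \<in> P. \<exists>x y c. p = pair M (pair M x y) c \<and> x \<sqsubset> y \<and> c \<sqsubset> numeral_of M k"
    using P(2) unfolding C_def less_numeral_of by blast
  ultimately have "colouring M k P" unfolding colouring_def using P(1) by blast
  moreover have "\<exists>i<k. c = numeral_of M i \<and> pair M x y \<in> Q i" if "pair M (pair M x y) c \<in> P" for x y c
    using that unfolding mem C_def by blast
  ultimately show ?thesis by blast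
qed

section \<open>From Ramsey's theorem to unions, and back\<close>

lemma RT2_imp_union:
  assumes RT: "RT2 M k"
  shows "union_H_wf M k"
  unfolding union_H_wf_def
proof (intro ballI allI impI)
  fix S and R :: "nat \<Rightarrow> 'a set"
  assume "S \<in> set_domain M" and R: "\<forall>i<k. relation_on M S (R i) \<and> H_wf M S (R i)"
  show "H_wf M S (\<Union>i<k. R i)" unfolding H_wf_iff_descending
  proof
    assume "\<exists>a. descending S (\<Union>i<k. R i) a"
    then obtain a where a: "descending S (\<Union>i<k. R i) a" by blast
    then have tot: "total_function M a" unfolding descending_def by blast
    \<comment> \<open>The sets \<open>Q i\<close> are chosen outside the model; as \<open>k\<close>
      is external, only each single one has to belong to it.\<close>
    have "\<exists>Q. i < k \<longrightarrow> Q \<in> set_domain M \<and>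
      (\<forall>x y. pair M x y \<in> Q \<longleftrightarrow> (\<exists>u v. pair M x u \<in> a \<and> pair M y v \<in> a \<and> pair M v u \<in> R i))" for i
    proof (cases "i < k")
      case True
      then have "R i \<in> set_domain M" using R relation_on_dom by blast
      then show ?thesis using descending_pairs_set[OF tot] by metis
    qed blast
    then obtain Q where Q: "\<And>i. i < k \<Longrightarrow> Q i \<in> set_domain M"
      "\<And>i x y. i < k \<Longrightarrow> pair M x y \<in> Q i \<longleftrightarrow> (\<exists>u v. pair M x u \<in> a \<and> pair M y v \<in> a \<and> pair M v u \<in> R i)"
      by metis
    have cover: "\<exists>i<k. pair M x y \<in> Q i" if "x \<sqsubset> y" for x y
    proof -
      obtain u v where uv: "pair M x u \<in> a" "pair M y v \<in> a" using total_functionD(2)[OF tot] by blast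
      then have "pair M v u \<in> (\<Union>i<k. R i)" using a that unfolding descending_def by blast
      then show ?thesis using Q(2) uv by blast
    qed
    obtain P where P: "colouring M k P"
      "\<And>x y c. pair M (pair M x y) c \<in> P \<Longrightarrow> \<exists>i<k. c = numeral_of M i \<and> pair M x y \<in> Q i"
      using colouring_exists[OF Q(1) cover] by blast
    obtain A c where A: "infinite_set M A" "\<And>x y. x \<in> A \<Longrightarrow> y \<in> A \<Longrightarrow> x \<sqsubset> y \<Longrightarrow> pair M (pair M x y) c \<in> P"
      using RT P(1) unfolding RT2_def by blast
    \<comment> \<open>Two elements of the homogeneous set show that \<open>c\<close> is an actual
      colour, hence the numeral of an external index.\<close>
    obtain x y where "x \<in> A" "y \<in> A" "x \<sqsubset> y" using A(1) unfolding infinite_set_def by blast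
    then obtain i where i: "i < k" "c = numeral_of M i" using A(2) P(2) by blast
    have AQ: "pair M x y \<in> Q i" if "x \<in> A" "y \<in> A" "x \<sqsubset> y" for x y
      using P(2)[OF A(2)[OF that]] unfolding i(2) numeral_of_inject by blast
    obtain b where b: "total_function M b" "\<And>n x. pair M n x \<in> b \<Longrightarrow> x \<in> A"
      "\<And>m n x y. m \<sqsubset> n \<Longrightarrow> pair M m x \<in> b \<Longrightarrow> pair M n y \<in> b \<Longrightarrow> x \<sqsubset> y"
      using infinite_set_enumeration[OF A(1)] by blast
    \<comment> \<open>The subsequence of \<open>a\<close> along the enumeration \<open>b\<close> of
      the homogeneous set.\<close>
    define G where "G n u = (\<exists>h. pair M n h \<in> b \<and> pair M h u \<in> a)" for n u
    have "sigma1 (\<lambda>e. G (e 0) (e 1))"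
      unfolding G_def by (intro sigma1_ex_delta0 delta0_intros term_fn_intros total_functionD(1) tot b(1))
    moreover have "\<exists>!u. G n u" for n
    proof -
      obtain h u where "pair M n h \<in> b" "pair M h u \<in> a"
        using total_functionD(2)[OF tot] total_functionD(2)[OF b(1)] by blast
      moreover have "u = v" if "G n u" "G n v" for u v
        using that total_functionD(3)[OF tot] total_functionD(3)[OF b(1)] unfolding G_def by metis
      ultimately show ?thesis unfolding G_def by blast
    qed
    ultimately obtain f where f: "total_function M f" "\<And>n u. pair M n u \<in> f \<longleftrightarrow> G n u"
      by (rule total_function_exists) blast
    have "descending S (R i) f" unfolding descending_def
    proof (intro conjI allI impI)
      show "u \<in> S" if "pair M n u \<in> f" for n u
        using that a unfolding f G_def descending_def by blast
      fix m n u v assume "m \<sqsubset> n" "pair M m u \<in> f" "pair M n v \<in> f"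
      then obtain x y where xy: "pair M m x \<in> b" "pair M x u \<in> a" "pair M n y \<in> b" "pair M y v \<in> a"
        unfolding f G_def by blast
      then have "x \<sqsubset> y" using b(3)[OF \<open>m \<sqsubset> n\<close>] by blast
      then have "pair M x y \<in> Q i" using AQ b(2) xy by blast
      then obtain u' v' where "pair M x u' \<in> a" "pair M y v' \<in> a" "pair M v' u' \<in> R i"
        using Q(2)[OF i(1)] by blast
      then show "pair M v u \<in> R i" using total_functionD(3)[OF tot] xy by metis
    qed fact
    then show False using R i(1) unfolding H_wf_iff_descending by blast
  qed
qed

lemma union_imp_RT2:
  assumes union: "union_H_wf M k"
  shows "RT2 M k"
  unfolding RT2_def
proof (intro allI impI)
  fix P assume P: "colouring M k P"
  then have P_dom: "P \<in> set_domain M" unfolding colouring_def by blast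
  \<comment> \<open>The components are swapped because in \<open>H_of\<close> the later entry is
    related to the earlier one.\<close>
  define R where "R i = {p. \<exists>x y. p = pair M y x \<and> x \<sqsubset> y \<and> pair M (pair M x y) (numeral_of M i) \<in> P}" for i
  have mem: "pair M y x \<in> R i \<longleftrightarrow> x \<sqsubset> y \<and> pair M (pair M x y) (numeral_of M i) \<in> P" for x y i
    unfolding R_def by (auto simp: pair_inject)
  have "R i \<in> set_domain M" for i
  proof -
    have "delta0 (\<lambda>e. \<exists>x. x \<sqsubset> e 0 \<oplus> \<one> \<and> (\<exists>y. y \<sqsubset> e 0 \<oplus> \<one> \<and>
      e 0 = pair M y x \<and> x \<sqsubset> y \<and> pair M (pair M x y) (numeral_of M i) \<in> P))"
      by (intro delta0_intros term_fn_intros P_dom)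
    then obtain X where X: "X \<in> set_domain M" "\<And>p. p \<in> X \<longleftrightarrow> (\<exists>x. x \<sqsubset> p \<oplus> \<one> \<and> (\<exists>y. y \<sqsubset> p \<oplus> \<one> \<and>
      p = pair M y x \<and> x \<sqsubset> y \<and> pair M (pair M x y) (numeral_of M i) \<in> P))"
      by (rule delta0_comprehension) blast
    have "X = R i" unfolding set_eq_iff X R_def mem_Collect_eq less_succ using le_pair1 le_pair2 by blast
    then show ?thesis using X(1) by simp
  qed
  then have rel: "relation_on M UNIV (R i)" for i
    unfolding relation_on_def R_def by blast
  have "delta0 (\<lambda>e. e 0 = e 0)" by (intro delta0_intros term_fn_intros)
  then obtain U where "U \<in> set_domain M" "\<And>n. n \<in> U \<longleftrightarrow> n = n"
    by (rule delta0_comprehension) blast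
  then have UNIV: "UNIV \<in> set_domain M" by (metis UNIV_eq_I)
  \<comment> \<open>The identity is descending for the union of the \<open>R i\<close>, since each
    pair has a colour below \<open>k\<close>.\<close>
  have "sigma1 (\<lambda>e. e 1 = e 0)" by (intro sigma1_delta0 delta0_intros term_fn_intros)
  then obtain I where I: "total_function M I" "\<And>n x. pair M n x \<in> I \<longleftrightarrow> x = n"
    by (rule total_function_exists[of "\<lambda>n x. x = n"]) blast+
  have "descending UNIV (\<Union>i<k. R i) I" unfolding descending_def
  proof (intro conjI allI impI)
    fix m n x y assume "m \<sqsubset> n" "pair M m x \<in> I" "pair M n y \<in> I"
    then have "x \<sqsubset> y" unfolding I by blast
    then obtain c where "pair M (pair M x y) c \<in> P" using P unfolding colouring_def by blast
    moreover from this obtain x' y' c' where "pair M (pair M x y) c = pair M (pair M x' y') c'" "c' \<sqsubset> numeral_of M k"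
      using P unfolding colouring_def by blast
    ultimately obtain i where "i < k" "pair M (pair M x y) (numeral_of M i) \<in> P"
      unfolding pair_inject less_numeral_of by blast
    then show "pair M y x \<in> (\<Union>i<k. R i)" using \<open>x \<sqsubset> y\<close> mem by blast
  qed (use I in auto)
  then have "\<not> H_wf M UNIV (\<Union>i<k. R i)" unfolding H_wf_iff_descending by blast
  then obtain i where i: "\<not> H_wf M UNIV (R i)"
    using union UNIV rel unfolding union_H_wf_def by blast
  then obtain a where a: "descending UNIV (R i) a" unfolding H_wf_iff_descending by blast
  then have tot: "total_function M a" unfolding descending_def by blast
  have aR: "pair M y x \<in> R i" if "m \<sqsubset> n" "pair M m x \<in> a" "pair M n y \<in> a" for m n x y
    using a that unfolding descending_def by blast
  have step: "x \<sqsubset> y" if "pair M n x \<in> a" "pair M (n \<oplus> \<one>) y \<in> a" for n x y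
    using aR[OF less_succ_self that] mem by blast
  have ge: "n \<sqsubseteq> x" if "pair M n x \<in> a" for n x
    using tot step that by (rule strictly_increasing_ge)
  \<comment> \<open>The homogeneous set is the range of \<open>a\<close>; by \<open>ge\<close> its
    index quantifier can be bounded by the value.\<close>
  have "delta0 (\<lambda>e. \<exists>n. n \<sqsubset> e 0 \<oplus> \<one> \<and> pair M n (e 0) \<in> a)"
    by (intro delta0_intros term_fn_intros total_functionD(1)[OF tot])
  then obtain A where A: "A \<in> set_domain M" "\<And>x. x \<in> A \<longleftrightarrow> (\<exists>n. n \<sqsubset> x \<oplus> \<one> \<and> pair M n x \<in> a)"
    by (rule delta0_comprehension) blast
  then have A': "x \<in> A \<longleftrightarrow> (\<exists>n. pair M n x \<in> a)" for x
    unfolding A less_succ using ge by blast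
  have "\<exists>m \<in> A. n \<sqsubset> m" for n
  proof -
    obtain x where x: "pair M (n \<oplus> \<one>) x \<in> a" using total_functionD(2)[OF tot] by blast
    then show ?thesis using ge[OF x] A' unfolding succ_le by blast
  qed
  then have "infinite_set M A" unfolding infinite_set_def using A(1) by blast
  moreover have "pair M (pair M x y) (numeral_of M i) \<in> P" if xy: "x \<in> A" "y \<in> A" "x \<sqsubset> y" for x y
  proof -
    obtain m n where mn: "pair M m x \<in> a" "pair M n y \<in> a" using xy A' by blast
    \<comment> \<open>The order of the values determines that of the indices: equal indices would
      give equal values, and reversed ones would give \<open>y \<sqsubset> x\<close>.\<close>
    have "m \<noteq> n" using mn total_functionD(3)[OF tot] xy(3) less_irrefl by metis
    moreover have "\<not> n \<sqsubset> m" using aR[OF _ mn(2,1)] mem xy(3) N.less_asym by blast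
    ultimately have "m \<sqsubset> n" using less_linear by blast
    then show ?thesis using aR[OF _ mn] mem by blast
  qed
  ultimately show "\<exists>A. infinite_set M A \<and> (\<exists>c. \<forall>x \<in> A. \<forall>y \<in> A. x \<sqsubset> y \<longrightarrow> pair M (pair M x y) c \<in> P)"
    by blast
qed

end

theorem theorem4p2:
  fixes M :: "'a l2_structure" and k :: nat
  assumes "RCA0_model M"
  shows "(union_ind_H_wf M k \<longleftrightarrow> union_H_wf M k) \<and> (union_H_wf M k \<longleftrightarrow> RT2 M k)"
proof -
  interpret rca0 M by standard fact
  show ?thesis using union_ind_iff_union union_imp_RT2 RT2_imp_union by blast
qed

end
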